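(* Let $T>0$, let $\rho_0,\rho_f\in\mathcal P_2(\mathbb R^n)$ be probability densities, let $v=(v_1,\dots,v_n)$ be a velocity field (feedback controller), and let $\rho(t,\cdot)$ be the density of the state $x(t)$ of $\dot x(t)=v(t,x(t))$, $x(0)\sim\rho_0$, which solves in the classical sense the continuity equation $\partial_t\rho(t,x)=-\nabla_x\cdot(\rho(t,x)v(t,x))$ for $(t,x)\in(0,\infty)\times\mathbb R^n$, with $\rho(0,x)=\rho_0(x)$. Assume that for almost all $t\in(0,T)$ differentiation and integration can be interchanged as follows: $$\frac{\mathrm d}{\mathrm dt}SW_2(\rho(t,\cdot),\rho_f)^2=\int_{\mathcal S^{n-1}}\partial_t\big[W_2(\rho_\theta(t,\cdot),\rho_{f,\theta})^2\big]\,\sigma(\mathrm d\theta).$$ Assume also that for every $i\in\{1,\dots,n\}$ and $t\ge 0$, $\rho(t,x)v_i(t,x)\to 0$ as $|x_i|\to\infty$. Then for almost all $t\in(0,T)$, $$\frac{\mathrm d}{\mathrm dt}SW_2(\rho(t,\cdot),\rho_f)^2=2\int_{\mathbb R^n}\left[\int_{\mathcal S^{n-1}}\big(\theta^\top x-\mathcal T_t^\theta(\theta^\top x)\big)\,\theta\,\sigma(\mathrm d\theta)\right]^\top v(t,x)\,\rho(t,x)\,\mathrm dx,$$ where $\mathcal T_t^\theta:\mathbb R\to\mathbb R$ is the unique optimal transport map from $\rho_\theta(t,\cdot)$ to $\rho_{f,\theta}$, that is, $W_2(\rho_\theta(t,\cdot),\rho_{f,\theta})^2=\int_{\mathbb R}|s-\mathcal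 T_t^\theta(s)|^2\rho_\theta(t,s)\,\mathrm ds$.
   Context: $\mathcal P_2(\mathbb R^n)$ is the set of Borel probability measures on $\mathbb R^n$ with finite second moment; the same symbol is used for a probability measure and its density. $\mathcal S^{n-1}$ is the unit sphere in $\mathbb R^n$ and $\sigma$ is the uniform probability measure on it. $W_2$ is the quadratic Wasserstein distance, $W_2(\mu,\nu)^2=\inf_{\gamma\in\Gamma(\mu,\nu)}\int\|x-y\|^2\gamma(\mathrm dx,\mathrm dy)$, with $\Gamma(\mu,\nu)$ the set of couplings of $\mu$ and $\nu$. For $\theta\in\mathcal S^{n-1}$, $P_\theta(x)=\theta^\top x$ and $P_\theta\#\mu$ is the push-forward of $\mu$ by $P_\theta$. The sliced Wasserstein distance is $SW_2(\mu,\nu)^2=\int_{\mathcal S^{n-1}}W_2(P_\theta\#\mu,P_\theta\#\nu)^2\,\sigma(\mathrm d\theta)$. $\rho_\theta(t,\cdot)$ and $\rho_{f,\theta}$ denote the densities of $P_\theta\#\rho(t,\cdot)$ and $P_\theta\#\rho_f$, respectively. It is assumed throughout that the state $x(t)$ admits a density $\rho(t,\cdot)$ solving the continuity equation classically.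
   Formalization: The formal theorem adds that the L²(ρ(t,·)) norm of v(t,·) is finite for almost all t and integrable over (0,T), without which the formula can fail even for n = 1, and takes the optimal maps to be jointly measurable in (θ,s) so that the sphere integral makes sense. *)

theory Defs
  imports "HOL-Probability.Probability"
begin

definition P2 :: "'a::euclidean_space measure set"
  where "P2 = {\<mu>. prob_space \<mu> \<and> sets \<mu> = sets borel \<and> integrable \<mu> (\<lambda>x. (norm x)\<^sup>2)}"

definition dens :: "('a::euclidean_space \<Rightarrow> real) \<Rightarrow> 'a measure"
  where "dens \<rho> = density lborel (\<lambda>x. ennreal (\<rho> x))"

definition prob_density_P2 :: "('a::euclidean_space \<Rightarrow> real) \<Rightarrow> bool"
  where "prob_density_P2 \<rho> \<longleftrightarrow> \<rho> \<in> borel_measurable borel \<and> (\<forall>x. 0 \<le> \<rho> x) \<and> dens \<rho> \<in> P2"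

text \<open>Normalised surface measure of the unit sphere, obtained by projecting the uniform
  distribution of the unit ball radially (the null event \<open>x = 0\<close> is discarded by the restriction).
  It is the rotation-invariant Borel probability measure on the sphere, see
  \<open>prob_space_sphere_unif\<close> and \<open>sphere_unif_invariant\<close> below (the index type of the latter is ordered only because the
  library's change of variables asks for it). For \<open>n = 1\<close> it gives mass 1/2
  to each of 1 and -1.\<close>

definition sphere_unif :: "'a::euclidean_space measure"
  where "sphere_unif =
    restrict_space (distr (uniform_measure lborel (cball 0 1)) borel sgn) (sphere 0 1)"

definition couplings :: "'a::euclidean_space measure \<Rightarrow> 'a measure \<Rightarrow> ('a \<times> 'a) measure set"
  where "couplings \<mu> \<nu> =
    {\<gamma>. sets \<gamma> = sets borel \<and> distr \<gamma> borel fst = \<mu> \<and> distr \<gamma> borel snd = \<nu>}"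

text \<open>The infimum is taken in the extended nonnegative reals, so that plans of infinite cost
  do not count as free; on \<open>P2\<close> the infimum is finite and \<open>enn2real\<close> is harmless.\<close>

definition W2 :: "'a::euclidean_space measure \<Rightarrow> 'a measure \<Rightarrow> real"
  where "W2 \<mu> \<nu> =
    sqrt (enn2real (INF \<gamma>\<in>couplings \<mu> \<nu>. \<integral>\<^sup>+ z. ennreal ((norm (fst z - snd z))\<^sup>2) \<partial>\<gamma>))"

definition proj :: "'a::euclidean_space \<Rightarrow> 'a measure \<Rightarrow> real measure"
  where "proj \<theta> \<mu> = distr \<mu> borel (\<lambda>x. \<theta> \<bullet> x)"

definition SW2 :: "'a::euclidean_space measure \<Rightarrow> 'a measure \<Rightarrow> real"
  where "SW2 \<mu> \<nu> = sqrt (\<integral>\<theta>. (W2 (proj \<theta> \<mu>) (proj \<theta> \<nu>))\<^sup>2 \<partial>sphere_unif)"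

definition optimal_map :: "'a::euclidean_space measure \<Rightarrow> 'a measure \<Rightarrow> ('a \<Rightarrow> 'a) \<Rightarrow> bool"
  where "optimal_map \<mu> \<nu> S \<longleftrightarrow>
    S \<in> borel_measurable borel \<and> distr \<mu> borel S = \<nu> \<and>
    (W2 \<mu> \<nu>)\<^sup>2 = (\<integral>s. (norm (s - S s))\<^sup>2 \<partial>\<mu>)"

definition divergence :: "(real ^ 'n \<Rightarrow> real ^ 'n) \<Rightarrow> real ^ 'n \<Rightarrow> real"
  where "divergence F x = trace (jacobian F (at x))"

definition classical_continuity_eq ::
    "(real \<Rightarrow> real ^ 'n \<Rightarrow> real) \<Rightarrow> (real \<Rightarrow> real ^ 'n \<Rightarrow> real ^ 'n) \<Rightarrow> bool"
  where "classical_continuity_eq \<rho> v \<longleftrightarrow>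
    (\<forall>t>0. \<forall>x. (\<lambda>y. \<rho> t y *\<^sub>R v t y) differentiable (at x) \<and>
       ((\<lambda>s. \<rho> s x) has_real_derivative - divergence (\<lambda>y. \<rho> t y *\<^sub>R v t y) x) (at t))"

definition state_process ::
    "'w measure \<Rightarrow> (real \<Rightarrow> 'w \<Rightarrow> 'a::euclidean_space) \<Rightarrow> (real \<Rightarrow> 'a \<Rightarrow> 'a) \<Rightarrow> (real \<Rightarrow> 'a \<Rightarrow> real) \<Rightarrow> bool"
  where "state_process M X v \<rho> \<longleftrightarrow>
    prob_space M \<and>
    (AE \<omega> in M. \<forall>t\<ge>0. ((\<lambda>s. X s \<omega>) has_vector_derivative v t (X t \<omega>)) (at t within {0..})) \<and>
    (\<forall>t\<ge>0. distributed M lborel (X t) (\<lambda>x. ennreal (\<rho> t x)))"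

text \<open>The usual regularity of the velocity field of a curve that is absolutely continuous with
  respect to \<open>W2\<close>: the norm of \<open>v t\<close> in \<open>L\<^sup>2(\<rho> t)\<close> is integrable over \<open>(0, T)\<close>. Without it the
  derivative formula for \<open>SW2\<close> fails, even for smooth \<open>\<rho>\<close> and \<open>v\<close> in dimension one:
  ever faster oscillations of ever smaller masses far out change the integral in the formula
  but not the derivative. The condition also keeps \<open>\<rho> t\<close> in \<open>P2\<close> when \<open>\<rho> 0\<close> is.\<close>

definition L2_velocity :: "real \<Rightarrow> (real \<Rightarrow> 'a::euclidean_space \<Rightarrow> real) \<Rightarrow> (real \<Rightarrow> 'a \<Rightarrow> 'a) \<Rightarrow> bool"
  where "L2_velocity T \<rho> v \<longleftrightarrow>
    (AE t in lborel. t \<in> {0<..<T} \<longrightarrow> integrable lborel (\<lambda>x. (norm (v t x))\<^sup>2 * \<rho> t x)) \<and>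
    set_integrable lborel {0<..<T} (\<lambda>t. sqrt (\<integral>x. (norm (v t x))\<^sup>2 * \<rho> t x \<partial>lborel))"

text \<open>Interchanging the derivative with the integral over the sphere includes the existence of
  all derivatives and of the integral involved.\<close>

definition interchange_at :: "(real \<Rightarrow> 'a::euclidean_space measure) \<Rightarrow> 'a measure \<Rightarrow> real \<Rightarrow> bool"
  where "interchange_at \<mu> \<nu> t \<longleftrightarrow>
    (AE \<theta> in sphere_unif. (\<lambda>s. (W2 (proj \<theta> (\<mu> s)) (proj \<theta> \<nu>))\<^sup>2) differentiable (at t)) \<and>
    integrable sphere_unif (\<lambda>\<theta>. deriv (\<lambda>s. (W2 (proj \<theta> (\<mu> s)) (proj \<theta> \<nu>))\<^sup>2) t) \<and>
    ((\<lambda>s. (SW2 (\<mu> s) \<nu>)\<^sup>2) has_real_derivative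
      (\<integral>\<theta>. deriv (\<lambda>s. (W2 (proj \<theta> (\<mu> s)) (proj \<theta> \<nu>))\<^sup>2) t \<partial>sphere_unif)) (at t)"

lemma space_sphere_unif: "space (sphere_unif :: 'a::euclidean_space measure) = sphere 0 1"
  by (simp add: sphere_unif_def space_restrict_space)

lemma sets_sphere_unif:
  "sets (sphere_unif :: 'a::euclidean_space measure) = sets (restrict_space borel (sphere 0 1))"
  by (simp add: sphere_unif_def sets_restrict_space)

lemma emeasure_sphere_unif:
  fixes A :: "'a::euclidean_space set"
  assumes A: "A \<in> sets borel" "A \<subseteq> sphere 0 1"
  shows "emeasure sphere_unif A =
    emeasure (uniform_measure lborel (cball 0 1)) {x. sgn x \<in> A}"
proof -
  have sgn: "(sgn :: 'a \<Rightarrow> 'a) \<in> borel_measurable borel"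
    unfolding sgn_div_norm[abs_def] by measurable
  have "emeasure sphere_unif A =
      emeasure (distr (uniform_measure lborel (cball 0 1)) borel (sgn :: 'a \<Rightarrow> 'a)) A"
    unfolding sphere_unif_def by (rule emeasure_restrict_space) (use A in auto)
  also have "\<dots> = emeasure (uniform_measure lborel (cball 0 1)) {x. sgn x \<in> A}"
    using A sgn by (subst emeasure_distr) (auto simp: vimage_def)
  finally show ?thesis .
qed

lemma prob_space_sphere_unif: "prob_space (sphere_unif :: 'a::euclidean_space measure)"
proof
  let ?B = "cball (0::'a) 1"
  let ?U = "uniform_measure lborel ?B"
  have pos: "emeasure lborel ?B \<noteq> 0"
    using content_cball_pos[of 1 "0::'a"] by (simp add: measure_def) force
  have fin: "emeasure lborel ?B \<noteq> \<infinity>"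
    using emeasure_lborel_cball_finite[of "0::'a" 1] by auto
  interpret U: prob_space ?U
    by (rule prob_space_uniform_measure[OF pos fin])
  have s: "{x. sgn x \<in> sphere (0::'a) 1} = - {0}"
    by (auto simp: norm_sgn simp del: sgn_zero_iff)
  have "emeasure ?U {0::'a} = 0"
    by (subst emeasure_uniform_measure)
      (auto simp: emeasure_lborel_countable divide_ennreal_def)
  then have "AE x in ?U. x \<in> - {0::'a}"
    by (intro AE_I[of _ _ "{0}"]) auto
  then have "emeasure ?U (- {0::'a}) = 1"
    by (intro U.emeasure_eq_1_AE) auto
  then show "emeasure sphere_unif (space (sphere_unif :: 'a measure)) = 1"
    unfolding space_sphere_unif using emeasure_sphere_unif[of "sphere (0::'a) 1"] unfolding s by simp
qed

lemma sphere_unif_invariant: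
  fixes f :: "real ^ 'n::{finite,wellorder} \<Rightarrow> real ^ 'n::_"
  assumes f: "orthogonal_transformation f"
  shows "distr sphere_unif sphere_unif f = sphere_unif"
proof (rule measure_eqI)
  fix A :: "(real ^ 'n::_) set"
  assume "A \<in> sets (distr sphere_unif sphere_unif f)"
  then have A: "A \<in> sets (sphere_unif :: (real ^ 'n::_) measure)" by simp
  then have Ab: "A \<in> sets borel" "A \<subseteq> sphere 0 1"
    by (auto simp: sets_sphere_unif sets_restrict_space)
  have lin: "linear f" and nf: "norm (f x) = norm x" for x
    using f by (auto simp: orthogonal_transformation)
  have cont: "continuous_on UNIV f"
    using lin linear_continuous_on linear_conv_bounded_linear by blast
  have fb: "f \<in> borel_measurable borel"
    by (rule borel_measurable_continuous_onI[OF cont])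
  have fm: "f \<in> measurable sphere_unif sphere_unif"
    unfolding measurable_cong_sets[OF sets_sphere_unif sets_sphere_unif]
    by (rule measurable_restrict_space3[OF fb]) (auto simp: nf)
  have fsgn: "f (sgn x) = sgn (f x)" for x
    by (simp add: sgn_div_norm nf linear_cmul[OF lin])
  have sgn: "(sgn :: real ^ 'n::_ \<Rightarrow> _) \<in> borel_measurable borel"
    unfolding sgn_div_norm[abs_def] by measurable
  let ?C = "cball 0 1 \<inter> {x. sgn x \<in> A}" and ?D = "cball 0 1 \<inter> {x. f (sgn x) \<in> A}"
  have mC: "{x. sgn x \<in> A} \<in> sets borel"
    using measurable_sets[OF sgn Ab(1)] by (simp add: vimage_def)
  have mD: "{x. f (sgn x) \<in> A} \<in> sets borel"
    using measurable_sets[OF measurable_compose[OF sgn fb] Ab(1)] by (simp add: vimage_def)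
  have surj: "\<exists>y. f y = x" for x
    using orthogonal_transformation_surj[OF f] by (metis surjD)
  have img: "f ` ?D = ?C"
  proof (intro set_eqI iffI)
    fix y assume y: "y \<in> ?C"
    obtain x where "f x = y" using surj by blast
    with y nf[of x] fsgn[of x] have "x \<in> ?D" by auto
    with \<open>f x = y\<close> show "y \<in> f ` ?D" by blast
  qed (auto simp: fsgn nf)
  have bD: "?D \<in> lmeasurable" and bC: "?C \<in> lmeasurable"
    using mC mD by (auto intro!: fmeasurable_Int_fmeasurable)
  have "measure lebesgue (f ` ?D) = measure lebesgue ?D"
    by (rule measure_orthogonal_image[OF f bD])
  then have "emeasure lebesgue ?C = emeasure lebesgue ?D"
    using bC bD by (simp add: img emeasure_eq_measure2)
  then have eq: "emeasure lborel ?C = emeasure lborel ?D"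
    using mC mD by simp
  have "emeasure (distr sphere_unif sphere_unif f) A = emeasure sphere_unif (f -` A \<inter> sphere 0 1)"
    by (simp add: emeasure_distr[OF fm A] space_sphere_unif)
  also have "\<dots> = emeasure (uniform_measure lborel (cball 0 1)) {x. sgn x \<in> f -` A \<inter> sphere 0 1}"
    using measurable_sets[OF fb Ab(1)] by (intro emeasure_sphere_unif) auto
  also have "{x. sgn x \<in> f -` A \<inter> sphere 0 1} = {x. f (sgn x) \<in> A}"
    using Ab(2) nf by fastforce
  also have "emeasure (uniform_measure lborel (cball 0 1)) \<dots> =
      emeasure (uniform_measure lborel (cball 0 1)) {x. sgn x \<in> A}"
    using mC mD eq by simp
  also have "\<dots> = emeasure sphere_unif A"
    using emeasure_sphere_unif[OF Ab] by simp
  finally show "emeasure (distr sphere_unif sphere_unif f) A = emeasure sphere_unif A" .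
qed simp

end

theory Submission
  imports Defs
begin

text \<open>
Why the formula holds. The state process couples the marginals at different times, so
transport plans at different times can be compared. Fix a time \<open>t\<close> and a direction \<open>\<theta>\<close>, and let
\<open>Y = \<T> t \<theta> (\<theta> \<bullet> X t)\<close>, a random variable with the projected target as its law. The pair
\<open>(\<theta> \<bullet> X s, Y)\<close> is a transport plan for every \<open>s\<close>, and the optimal one for \<open>s = t\<close>. So the
squared distance \<open>F s\<close> between the projections lies below \<open>g s = E (\<theta> \<bullet> X s - Y)\<^sup>2\<close> and touches
it at \<open>s = t\<close>. Where \<open>F\<close> is differentiable, its derivative must equal that of \<open>g\<close>, which is
\<open>2 E ((\<theta> \<bullet> X t - Y) (\<theta> \<bullet> v t (X t)))\<close> (\<open>derivative_of_touching_minorant\<close>,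
\<open>derivative_W2_square_to_fixed_target\<close>).

Since \<open>F\<close> is known to be differentiable, the difference quotients of \<open>g\<close> have to converge only
along one sequence of times on either side of \<open>t\<close>. The quotients of \<open>X\<close> converge
to \<open>v t (X t)\<close> along almost every path; if they are also bounded in \<open>L\<^sup>2\<close>, they converge
weakly in \<open>L\<^sup>2\<close> (\<open>L2_bounded_AE_LIMSEQ_imp_weak\<close>), and this suffices because \<open>\<theta> \<bullet> X t - Y\<close> is
square integrable. The bound comes from the Minkowski inequality: the \<open>L\<^sup>2\<close> norm of an increment of
\<open>X\<close> over an interval is at most the integral of the \<open>L\<^sup>2\<close> norm of the velocity
(\<open>flow_increment_L2_bound\<close>). The latter norm is integrable in time, so by Fatou its averages over
\<open>[t - 1/n, t + 1/n]\<close> have a finite lower limit for almost every \<open>t\<close>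
(\<open>AE_liminf_averages_finite\<close>). The exceptional times do not depend on \<open>\<theta>\<close>.

It remains to integrate over the sphere, which the interchange hypothesis permits, and to exchange
the integrals over \<open>\<theta>\<close> and \<open>x\<close> by Fubini (\<open>sphere_integral_swap\<close>). The displacement
\<open>\<theta> \<bullet> x - \<T> t \<theta> (\<theta> \<bullet> x)\<close> is square integrable in \<open>(\<theta>, x)\<close>, because for each \<open>\<theta>\<close> its second
moment is controlled by the second moments of the state and of the target
(\<open>nn_integral_projected_displacement_le\<close>).
\<close>

section \<open>Square integrable functions\<close>

lemma norm_diff_square_le:
  fixes x y :: "'a::real_normed_vector"
  shows "(norm (x - y))\<^sup>2 \<le> 2 * (norm x)\<^sup>2 + 2 * (norm y)\<^sup>2"
proof -
  have "(norm (x - y))\<^sup>2 \<le> (norm x + norm y)\<^sup>2"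
    using norm_triangle_ineq4[of x y] by (intro power_mono) auto
  also have "\<dots> \<le> 2 * (norm x)\<^sup>2 + 2 * (norm y)\<^sup>2"
    using sum_squares_bound[of "norm x" "norm y"] by (simp add: power2_sum)
  finally show ?thesis .
qed

lemma inner_unit_square_le:
  assumes "norm \<theta> = 1"
  shows "(\<theta> \<bullet> x)\<^sup>2 \<le> (norm x)\<^sup>2"
  using Cauchy_Schwarz_ineq2[of \<theta> x] assms by (simp add: abs_le_square_iff[symmetric])

lemma integrable_mult_of_L2:
  fixes f g :: "'a \<Rightarrow> real"
  assumes [measurable]: "f \<in> borel_measurable M" "g \<in> borel_measurable M"
    and "integrable M (\<lambda>x. (f x)\<^sup>2)" "integrable M (\<lambda>x. (g x)\<^sup>2)"
  shows "integrable M (\<lambda>x. f x * g x)"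
proof (rule Bochner_Integration.integrable_bound)
  show "integrable M (\<lambda>x. (f x)\<^sup>2 + (g x)\<^sup>2)"
    using assms by simp
  have "\<bar>a * b\<bar> \<le> a\<^sup>2 + b\<^sup>2" for a b :: real
  proof -
    have "\<bar>a\<bar> * \<bar>b\<bar> \<ge> 0" by simp
    then show ?thesis
      using sum_squares_bound[of "\<bar>a\<bar>" "\<bar>b\<bar>"] unfolding abs_mult power2_abs by linarith
  qed
  then show "AE x in M. norm (f x * g x) \<le> norm ((f x)\<^sup>2 + (g x)\<^sup>2)"
    by simp
qed measurable

lemma integrable_norm_square_diff:
  fixes f g :: "'a \<Rightarrow> 'b::euclidean_space"
  assumes [measurable]: "f \<in> borel_measurable M" "g \<in> borel_measurable M"
    and "integrable M (\<lambda>x. (norm (f x))\<^sup>2)" "integrable M (\<lambda>x. (norm (g x))\<^sup>2)"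
  shows "integrable M (\<lambda>x. (norm (f x - g x))\<^sup>2)"
proof (rule Bochner_Integration.integrable_bound)
  show "integrable M (\<lambda>x. 2 * (norm (f x))\<^sup>2 + 2 * (norm (g x))\<^sup>2)"
    using assms by simp
  show "AE x in M. norm ((norm (f x - g x))\<^sup>2) \<le> norm (2 * (norm (f x))\<^sup>2 + 2 * (norm (g x))\<^sup>2)"
    using norm_diff_square_le[of "f _" "g _"] by (intro AE_I2) simp
qed measurable

lemmas integrable_square_diff = integrable_norm_square_diff[where 'b = real, unfolded real_norm_def power2_abs]

lemma ennreal_square_le_cancel:
  fixes a b :: ennreal
  assumes "a\<^sup>2 \<le> b\<^sup>2"
  shows "a \<le> b"
proof (cases a; cases b)
  fix x y assume "a = ennreal x" "0 \<le> x" "b = ennreal y" "0 \<le> y"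
  with assms show ?thesis by (auto simp: ennreal_power power2_le_iff_abs_le)
qed (use assms in \<open>auto simp: ennreal_power top_unique\<close>)

text \<open>Writing the square of the inner integral as a double integral over \<open>r\<close> and \<open>s\<close> leaves
\<open>\<integral>V r * V s\<close>, to which Cauchy-Schwarz applies. The usual duality proof divides by the left-hand
side and would need its finiteness first.\<close>

lemma nn_integral_Minkowski_L2:
  fixes V :: "'a \<Rightarrow> 'b \<Rightarrow> ennreal"
  assumes "sigma_finite_measure N" "sigma_finite_measure M"
    and V[measurable]: "case_prod V \<in> borel_measurable (N \<Otimes>\<^sub>M M)"
    and h[measurable]: "h \<in> borel_measurable N"
    and bound: "AE r in N. (\<integral>\<^sup>+ \<omega>. (V r \<omega>)\<^sup>2 \<partial>M) \<le> (h r)\<^sup>2"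
  shows "(\<integral>\<^sup>+ \<omega>. (\<integral>\<^sup>+ r. V r \<omega> \<partial>N)\<^sup>2 \<partial>M) \<le> (\<integral>\<^sup>+ r. h r \<partial>N)\<^sup>2"
proof -
  interpret N: sigma_finite_measure N by fact
  interpret M: sigma_finite_measure M by fact
  interpret NM: pair_sigma_finite N M ..
  have Vr[measurable]: "r \<in> space N \<Longrightarrow> V r \<in> borel_measurable M" for r
    by measurable
  have cs: "(\<integral>\<^sup>+ \<omega>. V r \<omega> * V s \<omega> \<partial>M) \<le> h r * h s"
    if "(\<integral>\<^sup>+ \<omega>. (V r \<omega>)\<^sup>2 \<partial>M) \<le> (h r)\<^sup>2" "(\<integral>\<^sup>+ \<omega>. (V s \<omega>)\<^sup>2 \<partial>M) \<le> (h s)\<^sup>2"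
      and [measurable]: "r \<in> space N" "s \<in> space N" for r s
  proof -
    have "(\<integral>\<^sup>+ \<omega>. V r \<omega> * V s \<omega> \<partial>M)\<^sup>2 \<le> (\<integral>\<^sup>+ \<omega>. (V r \<omega>)\<^sup>2 \<partial>M) * (\<integral>\<^sup>+ \<omega>. (V s \<omega>)\<^sup>2 \<partial>M)"
      by (rule Cauchy_Schwarz_nn_integral) measurable
    also have "\<dots> \<le> (h r)\<^sup>2 * (h s)\<^sup>2"
      using that by (intro mult_mono) auto
    finally show ?thesis
      using ennreal_square_le_cancel by (simp add: power_mult_distrib[symmetric])
  qed
  have "(\<integral>\<^sup>+ \<omega>. (\<integral>\<^sup>+ r. V r \<omega> \<partial>N)\<^sup>2 \<partial>M) = (\<integral>\<^sup>+ \<omega>. (\<integral>\<^sup>+ r. (\<integral>\<^sup>+ s. V r \<omega> * V s \<omega> \<partial>N) \<partial>N) \<partial>M)"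
    by (intro nn_integral_cong) (simp add: nn_integral_cmult nn_integral_multc power2_eq_square)
  also have "\<dots> = (\<integral>\<^sup>+ r. (\<integral>\<^sup>+ \<omega>. (\<integral>\<^sup>+ s. V r \<omega> * V s \<omega> \<partial>N) \<partial>M) \<partial>N)"
    by (rule NM.Fubini') measurable
  also have "\<dots> = (\<integral>\<^sup>+ r. (\<integral>\<^sup>+ s. (\<integral>\<^sup>+ \<omega>. V r \<omega> * V s \<omega> \<partial>M) \<partial>N) \<partial>N)"
    by (intro nn_integral_cong NM.Fubini') measurable
  also have "\<dots> \<le> (\<integral>\<^sup>+ r. (\<integral>\<^sup>+ s. h r * h s \<partial>N) \<partial>N)"
  proof (rule nn_integral_mono_AE)
    have inner: "(\<integral>\<^sup>+ s. (\<integral>\<^sup>+ \<omega>. V r \<omega> * V s \<omega> \<partial>M) \<partial>N) \<le> (\<integral>\<^sup>+ s. h r * h s \<partial>N)"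
      if r: "(\<integral>\<^sup>+ \<omega>. (V r \<omega>)\<^sup>2 \<partial>M) \<le> (h r)\<^sup>2" "r \<in> space N" for r
    proof (rule nn_integral_mono_AE)
      show "AE s in N. (\<integral>\<^sup>+ \<omega>. V r \<omega> * V s \<omega> \<partial>M) \<le> h r * h s"
        using bound AE_space by eventually_elim (rule cs[OF r(1) _ r(2)])
    qed
    from bound AE_space show "AE r in N. (\<integral>\<^sup>+ s. (\<integral>\<^sup>+ \<omega>. V r \<omega> * V s \<omega> \<partial>M) \<partial>N)
        \<le> (\<integral>\<^sup>+ s. h r * h s \<partial>N)"
      by eventually_elim (rule inner)
  qed
  also have "\<dots> = (\<integral>\<^sup>+ r. h r \<partial>N)\<^sup>2"
    by (simp add: nn_integral_cmult nn_integral_multc power2_eq_square)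
  finally show ?thesis .
qed

section \<open>Paths, their derivatives, and averages\<close>

text \<open>The derivative may be one-sided: at time 0 the paths are differentiable from the right only.\<close>

lemma difference_quotient_LIMSEQ:
  fixes f :: "real \<Rightarrow> 'a::real_normed_vector"
  assumes "(f has_vector_derivative D) (at x within S)"
    and y: "filterlim y (at x within S) sequentially"
  shows "(\<lambda>n. (f (y n) - f x) /\<^sub>R (y n - x)) \<longlonglongrightarrow> D"
proof -
  have "((\<lambda>z. ((f z - f x) - (z - x) *\<^sub>R D) /\<^sub>R norm (z - x)) \<longlongrightarrow> 0) (at x within S)"
    using assms(1) by (simp add: has_vector_derivative_def has_derivative_at_within)
  from filterlim_compose[OF this y]
  have "(\<lambda>n. ((f (y n) - f x) - (y n - x) *\<^sub>R D) /\<^sub>R norm (y n - x)) \<longlonglongrightarrow> 0" .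
  moreover have "eventually (\<lambda>n. norm (((f (y n) - f x) - (y n - x) *\<^sub>R D) /\<^sub>R norm (y n - x))
      = norm ((f (y n) - f x) /\<^sub>R (y n - x) - D)) sequentially"
  proof -
    have "eventually (\<lambda>n. y n \<noteq> x) sequentially"
      using y by (auto simp: filterlim_at elim: eventually_mono)
    then show ?thesis
    proof eventually_elim
      case (elim n)
      have "(f (y n) - f x) /\<^sub>R (y n - x) - D = ((f (y n) - f x) - (y n - x) *\<^sub>R D) /\<^sub>R (y n - x)"
        using elim by (simp add: scaleR_diff_right)
      then show ?case by simp
    qed
  qed
  ultimately have "(\<lambda>n. norm ((f (y n) - f x) /\<^sub>R (y n - x) - D)) \<longlonglongrightarrow> 0"
    by (subst (asm) tendsto_norm_zero_iff[symmetric]) (simp cong: tendsto_cong)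
  then show ?thesis by (simp add: tendsto_norm_zero_iff LIM_zero_iff)
qed

text \<open>If the right-hand side is finite, the derivative is Lebesgue integrable; since a
derivative is always gauge integrable with the increment as its integral, both integrals agree.\<close>

lemma norm_increment_le_nn_integral_derivative:
  fixes f :: "real \<Rightarrow> 'a::euclidean_space"
  assumes "a \<le> b"
    and deriv: "\<And>r. r \<in> {a..b} \<Longrightarrow> (f has_vector_derivative f' r) (at r within {a..b})"
    and meas: "(\<lambda>r. indicator {a..b} r *\<^sub>R f' r) \<in> borel_measurable lborel"
  shows "ennreal (norm (f b - f a)) \<le> (\<integral>\<^sup>+ r. ennreal (norm (f' r)) * indicator {a..b} r \<partial>lborel)"
proof (cases "(\<integral>\<^sup>+ r. ennreal (norm (f' r)) * indicator {a..b} r \<partial>lborel) = \<infinity>")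
  case False
  have eq: "ennreal (norm (indicator {a..b} r *\<^sub>R f' r)) = ennreal (norm (f' r)) * indicator {a..b} r" for r
    by (auto simp: indicator_def)
  have int: "set_integrable lborel {a..b} f'"
    unfolding set_integrable_def integrable_iff_bounded eq using meas False
    by (auto simp: top.not_eq_extremum)
  have "f b - f a = integral {a..b} f'"
    using fundamental_theorem_of_calculus[OF \<open>a \<le> b\<close> deriv] by (simp add: integral_unique)
  also have "\<dots> = (LINT r:{a..b}|lborel. f' r)"
    using set_borel_integral_eq_integral(2)[OF int] by simp
  finally have "norm (f b - f a) = norm (LINT r|lborel. indicator {a..b} r *\<^sub>R f' r)"
    by (simp add: set_lebesgue_integral_def)
  then show ?thesis
    using integral_norm_bound_ennreal[OF int[unfolded set_integrable_def]] unfolding eq by simp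
qed simp

text \<open>The values of \<open>X\<close> at times rounded down to multiples of \<open>1 / (n + 1)\<close> are jointly
measurable, since they involve only countably many times. By continuity of the paths they converge
to \<open>X\<close>, whose difference quotients in turn converge to the derivative. The derivative is extended
by zero to negative times.\<close>

lemma measurable_path_derivative:
  fixes X :: "real \<Rightarrow> 'w \<Rightarrow> 'a::euclidean_space"
  assumes X: "\<And>r. 0 \<le> r \<Longrightarrow> X r \<in> borel_measurable M"
    and deriv: "\<And>r \<omega>. 0 \<le> r \<Longrightarrow> \<omega> \<in> space M \<Longrightarrow>
      ((\<lambda>s. X s \<omega>) has_vector_derivative V r \<omega>) (at r within {0..})"
  shows "(\<lambda>(r, \<omega>). indicator {0..} r *\<^sub>R V r \<omega>) \<in> borel_measurable (borel \<Otimes>\<^sub>M M)"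
proof -
  let ?e = "\<lambda>n. 1 / real (Suc n)"
  have Xcont: "continuous_on {0..} (\<lambda>s. X s \<omega>)" if "\<omega> \<in> space M" for \<omega>
    using deriv[OF _ that] by (auto simp: continuous_on_eq_continuous_within intro: has_vector_derivative_continuous)
  have joint: "(\<lambda>(r, \<omega>). X (max 0 r) \<omega>) \<in> borel_measurable (borel \<Otimes>\<^sub>M M)"
  proof (rule borel_measurable_LIMSEQ_metric)
    fix n
    have "(\<lambda>p. X (max 0 (real_of_int \<lfloor>real (Suc n) * fst p\<rfloor> / real (Suc n))) (snd p))
        \<in> borel_measurable (borel \<Otimes>\<^sub>M M)"
    proof (rule measurable_compose_countable[where f = "\<lambda>i p. X (max 0 (real_of_int i / real (Suc n))) (snd p)"])
      show "(\<lambda>p. X (max 0 (real_of_int i / real (Suc n))) (snd p)) \<in> borel_measurable (borel \<Otimes>\<^sub>M M)" for i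
        by (rule measurable_compose[OF measurable_snd X]) simp
    qed measurable
    then show "(\<lambda>(r, \<omega>). X (max 0 (real_of_int \<lfloor>real (Suc n) * r\<rfloor> / real (Suc n))) \<omega>)
        \<in> borel_measurable (borel \<Otimes>\<^sub>M M)"
      by (simp add: case_prod_beta)
  next
    fix p assume "p \<in> space (borel \<Otimes>\<^sub>M M :: (real \<times> 'w) measure)"
    then obtain r \<omega> where p: "p = (r, \<omega>)" "\<omega> \<in> space M"
      by (auto simp: space_pair_measure)
    have "(\<lambda>n. real_of_int \<lfloor>real (Suc n) * r\<rfloor> / real (Suc n)) \<longlonglongrightarrow> r"
    proof (rule tendsto_sandwich)
      show "eventually (\<lambda>n. r - ?e n \<le> real_of_int \<lfloor>real (Suc n) * r\<rfloor> / real (Suc n)) sequentially"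
        proof (intro always_eventually allI)
        fix n
        have "real (Suc n) * r - 1 \<le> real_of_int \<lfloor>real (Suc n) * r\<rfloor>" by linarith
        then have "(real (Suc n) * r - 1) / real (Suc n) \<le> real_of_int \<lfloor>real (Suc n) * r\<rfloor> / real (Suc n)"
          by (rule divide_right_mono) simp
        then show "r - ?e n \<le> real_of_int \<lfloor>real (Suc n) * r\<rfloor> / real (Suc n)"
          by (simp add: diff_divide_distrib)
      qed
      show "eventually (\<lambda>n. real_of_int \<lfloor>real (Suc n) * r\<rfloor> / real (Suc n) \<le> r) sequentially"
        by (intro always_eventually allI) (simp add: divide_le_eq mult.commute)
      show "(\<lambda>n. r - ?e n) \<longlonglongrightarrow> r"
        using tendsto_diff[OF tendsto_const LIMSEQ_Suc[OF lim_1_over_n], of r] by simp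
    qed simp
    then have "(\<lambda>n. max 0 (real_of_int \<lfloor>real (Suc n) * r\<rfloor> / real (Suc n))) \<longlonglongrightarrow> max 0 r"
      by (intro tendsto_intros)
    from continuous_on_tendsto_compose[OF Xcont[OF p(2)] this]
    show "(\<lambda>n. case p of (r, \<omega>) \<Rightarrow> X (max 0 (real_of_int \<lfloor>real (Suc n) * r\<rfloor> / real (Suc n))) \<omega>)
        \<longlonglongrightarrow> (case p of (r, \<omega>) \<Rightarrow> X (max 0 r) \<omega>)"
      by (simp add: p)
  qed
  show ?thesis
  proof (rule borel_measurable_LIMSEQ_metric)
    fix n
    have [measurable]: "(\<lambda>p. X (max 0 (fst p)) (snd p)) \<in> borel_measurable (borel \<Otimes>\<^sub>M M)"
      using joint by (simp add: case_prod_beta)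
    have [measurable]: "(\<lambda>p. X (max 0 (max 0 (fst p) + ?e n)) (snd p)) \<in> borel_measurable (borel \<Otimes>\<^sub>M M)"
      by (rule measurable_compose[where f = "\<lambda>p. (max 0 (fst p) + ?e n, snd p)", OF _ joint, unfolded prod.case]) measurable
    show "(\<lambda>p. indicator {0..} (fst p) *\<^sub>R
        ((X (max 0 (max 0 (fst p) + ?e n)) (snd p) - X (max 0 (fst p)) (snd p)) /\<^sub>R ?e n))
        \<in> borel_measurable (borel \<Otimes>\<^sub>M M)"
      by measurable
  next
    fix p assume "p \<in> space (borel \<Otimes>\<^sub>M M :: (real \<times> 'w) measure)"
    then obtain r \<omega> where p: "p = (r, \<omega>)" "\<omega> \<in> space M"
      by (auto simp: space_pair_measure)
    show "(\<lambda>n. indicator {0..} (fst p) *\<^sub>R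
        ((X (max 0 (max 0 (fst p) + ?e n)) (snd p) - X (max 0 (fst p)) (snd p)) /\<^sub>R ?e n))
        \<longlonglongrightarrow> (case p of (r, \<omega>) \<Rightarrow> indicator {0..} r *\<^sub>R V r \<omega>)"
    proof (cases "0 \<le> r")
      case True
      have "filterlim (\<lambda>n. r + ?e n) (at r within {0..}) sequentially"
        unfolding filterlim_at
      proof
        show "(\<lambda>n. r + ?e n) \<longlonglongrightarrow> r"
          using tendsto_add[OF tendsto_const LIMSEQ_Suc[OF lim_1_over_n], of r] by simp
      qed (use True in auto)
      from difference_quotient_LIMSEQ[OF deriv[OF True p(2)] this]
      show ?thesis using True by (simp add: p)
    qed (simp add: p)
  qed
qed

text \<open>A weak substitute for the Lebesgue differentiation theorem: by Tonelli the averages have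
the same total integral for every \<open>n\<close>, so by Fatou their lower limit is integrable.\<close>

lemma AE_liminf_averages_finite:
  fixes h :: "real \<Rightarrow> ennreal"
  assumes [measurable]: "h \<in> borel_measurable borel"
    and fin: "(\<integral>\<^sup>+ r. h r \<partial>lborel) < \<infinity>"
  shows "AE t in lborel. liminf (\<lambda>n. ennreal (real (Suc n)) *
    (\<integral>\<^sup>+ r. h r * indicator {t - 1 / real (Suc n)..t + 1 / real (Suc n)} r \<partial>lborel)) < \<infinity>"
proof -
  let ?e = "\<lambda>n. 1 / real (Suc n)"
  let ?A = "\<lambda>n t. ennreal (real (Suc n)) * (\<integral>\<^sup>+ r. h r * indicator {t - ?e n..t + ?e n} r \<partial>lborel)"
  have swap: "indicator {t - ?e n..t + ?e n} r = (indicator {r - ?e n..r + ?e n} t :: ennreal)" for n t r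
    by (auto simp: indicator_def)
  have [measurable]: "(\<lambda>(r, t). h r * indicator {r - ?e n..r + ?e n} t) \<in> borel_measurable (lborel \<Otimes>\<^sub>M lborel)" for n
  proof -
    have "(\<lambda>(r, t). h r * indicator {p::real \<times> real. fst p - ?e n \<le> snd p \<and> snd p \<le> fst p + ?e n} (r, t))
        \<in> borel_measurable (lborel \<Otimes>\<^sub>M lborel)"
      by measurable
    then show ?thesis by (simp add: indicator_def)
  qed
  let ?B = "\<lambda>n t. \<integral>\<^sup>+ r. h r * indicator {r - ?e n..r + ?e n} t \<partial>lborel"
  have A_eq: "?A n t = ennreal (real (Suc n)) * ?B n t" for n t
    by (subst swap) (rule refl)
  have A: "?A n \<in> borel_measurable lborel" for n
    unfolding A_eq by measurable
  have int: "(\<integral>\<^sup>+ t. ?A n t \<partial>lborel) = 2 * (\<integral>\<^sup>+ r. h r \<partial>lborel)" for n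
  proof -
    have "(\<integral>\<^sup>+ t. ?A n t \<partial>lborel) = ennreal (real (Suc n)) *
        (\<integral>\<^sup>+ t. (\<integral>\<^sup>+ r. h r * indicator {r - ?e n..r + ?e n} t \<partial>lborel) \<partial>lborel)"
      unfolding A_eq by (rule nn_integral_cmult) measurable
    also have "(\<integral>\<^sup>+ t. (\<integral>\<^sup>+ r. h r * indicator {r - ?e n..r + ?e n} t \<partial>lborel) \<partial>lborel)
        = (\<integral>\<^sup>+ r. (\<integral>\<^sup>+ t. h r * indicator {r - ?e n..r + ?e n} t \<partial>lborel) \<partial>lborel)"
      by (rule lborel_pair.Fubini') measurable
    also have "\<dots> = (\<integral>\<^sup>+ r. h r * ennreal (2 * ?e n) \<partial>lborel)"
      by (intro nn_integral_cong) (simp add: nn_integral_cmult_indicator)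
    also have "\<dots> = (\<integral>\<^sup>+ r. h r \<partial>lborel) * ennreal (2 * ?e n)"
      by (rule nn_integral_multc) simp
    also have "ennreal (real (Suc n)) * \<dots> = (\<integral>\<^sup>+ r. h r \<partial>lborel) * (ennreal (real (Suc n)) * ennreal (2 * ?e n))"
      by (simp only: ac_simps)
    also have "ennreal (real (Suc n)) * ennreal (2 * ?e n) = ennreal 2"
      by (simp add: ennreal_mult[symmetric] del: of_nat_Suc)
    finally show ?thesis by (simp add: mult.commute)
  qed
  have "(\<integral>\<^sup>+ t. liminf (\<lambda>n. ?A n t) \<partial>lborel) \<le> liminf (\<lambda>n. \<integral>\<^sup>+ t. ?A n t \<partial>lborel)"
    by (rule nn_integral_liminf[OF A])
  also have "\<dots> = 2 * (\<integral>\<^sup>+ r. h r \<partial>lborel)"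
    unfolding int by (simp add: Liminf_const)
  also have "\<dots> < \<infinity>" using fin by (simp add: ennreal_mult_less_top)
  finally have "AE t in lborel. liminf (\<lambda>n. ?A n t) \<noteq> \<infinity>"
    using A by (intro nn_integral_noteq_infinite) auto
  then show ?thesis by (simp add: less_top)
qed

section \<open>Mean square difference quotients\<close>

text \<open>With \<open>D n = Q n - Q'\<close>, split \<open>\<bar>Z * D n\<bar>\<close> into \<open>e * (D n)\<^sup>2\<close>, whose integral is at most
\<open>e\<close> times a constant, and a remainder. By Young's inequality the positive part of the remainder is
dominated by \<open>Z\<^sup>2 / (4 * e)\<close>, so its integral tends to zero.\<close>

lemma L2_bounded_AE_LIMSEQ_imp_weak:
  fixes Q :: "nat \<Rightarrow> 'a \<Rightarrow> real" and Z Q' :: "'a \<Rightarrow> real"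
  assumes [measurable]: "Z \<in> borel_measurable M" "\<And>n. Q n \<in> borel_measurable M" "Q' \<in> borel_measurable M"
    and Z2: "integrable M (\<lambda>x. (Z x)\<^sup>2)"
    and Q2: "\<And>n. integrable M (\<lambda>x. (Q n x)\<^sup>2)" "\<And>n. (\<integral>x. (Q n x)\<^sup>2 \<partial>M) \<le> C"
    and Q'2: "integrable M (\<lambda>x. (Q' x)\<^sup>2)"
    and lim: "AE x in M. (\<lambda>n. Q n x) \<longlonglongrightarrow> Q' x"
  shows "(\<lambda>n. \<integral>x. Z x * Q n x \<partial>M) \<longlonglongrightarrow> (\<integral>x. Z x * Q' x \<partial>M)"
proof -
  define D where "D n x = Q n x - Q' x" for n x
  define K where "K = 2 * C + 2 * (\<integral>x. (Q' x)\<^sup>2 \<partial>M) + 1"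
  have [measurable]: "D n \<in> borel_measurable M" for n
    unfolding D_def by measurable
  have D2: "integrable M (\<lambda>x. (D n x)\<^sup>2)" for n
    unfolding D_def by (intro integrable_square_diff Q2 Q'2) measurable
  have K0: "K > 0"
  proof -
    have "0 \<le> (\<integral>x. (Q 0 x)\<^sup>2 \<partial>M)" "0 \<le> (\<integral>x. (Q' x)\<^sup>2 \<partial>M)" by simp_all
    then show ?thesis using Q2(2)[of 0] unfolding K_def by linarith
  qed
  have DK: "(\<integral>x. (D n x)\<^sup>2 \<partial>M) \<le> K" for n
  proof -
    have "(a - b)\<^sup>2 \<le> 2 * a\<^sup>2 + 2 * b\<^sup>2" for a b :: real
      using norm_diff_square_le[of a b] by simp
    then have "(\<integral>x. (D n x)\<^sup>2 \<partial>M) \<le> (\<integral>x. 2 * (Q n x)\<^sup>2 + 2 * (Q' x)\<^sup>2 \<partial>M)"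
      using D2 Q2(1) Q'2 by (intro integral_mono) (auto simp: D_def)
    also have "\<dots> = 2 * (\<integral>x. (Q n x)\<^sup>2 \<partial>M) + 2 * (\<integral>x. (Q' x)\<^sup>2 \<partial>M)"
      using Q2(1) Q'2 by simp
    finally show ?thesis using Q2(2)[of n] unfolding K_def by linarith
  qed
  have Dlim: "AE x in M. (\<lambda>n. D n x) \<longlonglongrightarrow> 0"
    using lim by eventually_elim (simp add: D_def LIM_zero)
  have "(\<lambda>n. \<integral>x. Z x * D n x \<partial>M) \<longlonglongrightarrow> 0"
  proof (rule LIMSEQ_I)
    fix \<delta> :: real assume "0 < \<delta>"
    \<comment> \<open>This choice leaves \<open>\<delta> / 2\<close> for the remainder \<open>R\<close>, as \<open>K\<close> bounds all second moments of \<open>D\<close>.\<close>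
    define e where "e = \<delta> / (2 * K)"
    have e0: "0 < e" using \<open>0 < \<delta>\<close> K0 by (simp add: e_def)
    define R where "R n x = max 0 (\<bar>Z x * D n x\<bar> - e * (D n x)\<^sup>2)" for n x
    have [measurable]: "R n \<in> borel_measurable M" for n
      unfolding R_def by measurable
    have young: "\<bar>a * b\<bar> - e * b\<^sup>2 \<le> a\<^sup>2 / (4 * e)" for a b :: real
    proof -
      have "0 \<le> (\<bar>a\<bar> - 2 * e * \<bar>b\<bar>)\<^sup>2" by simp
      also have "\<dots> = a\<^sup>2 - 4 * e * (\<bar>a * b\<bar> - e * b\<^sup>2)"
        by (simp add: power2_diff power_mult_distrib abs_mult algebra_simps power2_eq_square[of e])
      finally show ?thesis using e0 by (simp add: pos_le_divide_eq mult.commute)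
    qed
    have Rdom: "AE x in M. norm (R n x) \<le> (Z x)\<^sup>2 / (4 * e)" for n
      using young e0 by (auto simp: R_def)
    have Rlim: "AE x in M. (\<lambda>n. R n x) \<longlonglongrightarrow> 0"
      using Dlim
    proof eventually_elim
      case (elim x)
      have "(\<lambda>n. max 0 (\<bar>Z x * D n x\<bar> - e * (D n x)\<^sup>2)) \<longlonglongrightarrow> max 0 (\<bar>Z x * 0\<bar> - e * 0\<^sup>2)"
        by (intro tendsto_intros elim)
      then show ?case by (simp add: R_def)
    qed
    have Rint: "integrable M (R n)" for n
    proof (rule Bochner_Integration.integrable_bound)
      show "integrable M (\<lambda>x. (Z x)\<^sup>2 / (4 * e))" using Z2 by simp
      show "AE x in M. norm (R n x) \<le> norm ((Z x)\<^sup>2 / (4 * e))"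
        using Rdom[of n] by eventually_elim (use e0 in simp)
    qed measurable
    have "(\<lambda>n. \<integral>x. R n x \<partial>M) \<longlonglongrightarrow> (\<integral>x. 0 \<partial>M)"
      using Z2 by (intro integral_dominated_convergence[OF _ _ _ Rlim Rdom]) auto
    then obtain N where N: "\<And>n. n \<ge> N \<Longrightarrow> \<bar>\<integral>x. R n x \<partial>M\<bar> < \<delta> / 2"
      using LIMSEQ_D[of "\<lambda>n. \<integral>x. R n x \<partial>M" 0 "\<delta> / 2"] \<open>0 < \<delta>\<close> by auto
    show "\<exists>N. \<forall>n\<ge>N. norm ((\<integral>x. Z x * D n x \<partial>M) - 0) < \<delta>"
    proof (intro exI allI impI)
      fix n assume "n \<ge> N"
      have ZD: "integrable M (\<lambda>x. Z x * D n x)"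
        by (intro integrable_mult_of_L2 Z2 D2) measurable
      have "norm (\<integral>x. Z x * D n x \<partial>M) \<le> (\<integral>x. \<bar>Z x * D n x\<bar> \<partial>M)"
        using integral_norm_bound[of M "\<lambda>x. Z x * D n x"] by simp
      also have "\<dots> \<le> (\<integral>x. e * (D n x)\<^sup>2 + R n x \<partial>M)"
        using ZD D2 Rint by (intro integral_mono) (auto simp: R_def)
      also have "\<dots> = e * (\<integral>x. (D n x)\<^sup>2 \<partial>M) + (\<integral>x. R n x \<partial>M)"
        using D2 Rint by simp
      also have "\<dots> \<le> e * K + \<bar>\<integral>x. R n x \<partial>M\<bar>"
        using DK[of n] e0 by (intro add_mono mult_left_mono) auto
      also have "\<dots> < \<delta>"
        using N[OF \<open>n \<ge> N\<close>] K0 by (simp add: e_def)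
      finally show "norm ((\<integral>x. Z x * D n x \<partial>M) - 0) < \<delta>" by simp
    qed
  qed
  moreover have "(\<integral>x. Z x * D n x \<partial>M) = (\<integral>x. Z x * Q n x \<partial>M) - (\<integral>x. Z x * Q' x \<partial>M)" for n
    unfolding D_def right_diff_distrib
    by (intro Bochner_Integration.integral_diff integrable_mult_of_L2 Z2 Q2 Q'2) measurable
  ultimately show ?thesis by (simp add: LIM_zero_iff)
qed

text \<open>With \<open>D n = (U n - U') / e n\<close> the quotient equals
\<open>2 * (U' - Y) * D n + e n * (D n)\<^sup>2\<close> under the integral. The first term converges weakly and the
second vanishes because \<open>D n\<close> is bounded in \<open>L\<^sup>2\<close>.\<close>

lemma mean_square_difference_quotient_LIMSEQ:
  fixes U :: "nat \<Rightarrow> 'a \<Rightarrow> real" and U' Y Q :: "'a \<Rightarrow> real"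
  assumes [measurable]: "\<And>n. U n \<in> borel_measurable M" "U' \<in> borel_measurable M" "Y \<in> borel_measurable M"
      "Q \<in> borel_measurable M"
    and U2: "\<And>n. integrable M (\<lambda>x. (U n x)\<^sup>2)" "integrable M (\<lambda>x. (U' x)\<^sup>2)"
    and Y2: "integrable M (\<lambda>x. (Y x)\<^sup>2)" and Q2: "integrable M (\<lambda>x. (Q x)\<^sup>2)"
    and e: "e \<longlonglongrightarrow> 0" "\<And>n. e n \<noteq> 0"
    and bound: "\<And>n. (\<integral>x. (U n x - U' x)\<^sup>2 \<partial>M) \<le> C * (e n)\<^sup>2"
    and lim: "AE x in M. (\<lambda>n. (U n x - U' x) / e n) \<longlonglongrightarrow> Q x"
  shows "(\<lambda>n. ((\<integral>x. (U n x - Y x)\<^sup>2 \<partial>M) - (\<integral>x. (U' x - Y x)\<^sup>2 \<partial>M)) / e n)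
    \<longlonglongrightarrow> 2 * (\<integral>x. (U' x - Y x) * Q x \<partial>M)"
proof -
  define D where "D n x = (U n x - U' x) / e n" for n x
  have [measurable]: "D n \<in> borel_measurable M" for n
    unfolding D_def by measurable
  have Diff: "integrable M (\<lambda>x. (U n x - U' x)\<^sup>2)" for n
    by (intro integrable_square_diff U2) measurable
  have D2: "integrable M (\<lambda>x. (D n x)\<^sup>2)" for n
    unfolding D_def power_divide using Diff by simp
  have DC: "(\<integral>x. (D n x)\<^sup>2 \<partial>M) \<le> C" for n
    unfolding D_def power_divide using bound[of n] e(2)[of n] by (simp add: divide_le_eq)
  have Z2: "integrable M (\<lambda>x. (U' x - Y x)\<^sup>2)"
    by (intro integrable_square_diff U2 Y2) measurable
  have weak: "(\<lambda>n. \<integral>x. (U' x - Y x) * D n x \<partial>M) \<longlonglongrightarrow> (\<integral>x. (U' x - Y x) * Q x \<partial>M)"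
    by (rule L2_bounded_AE_LIMSEQ_imp_weak[OF _ _ _ Z2 D2 DC Q2])
      (use lim in \<open>auto simp: D_def\<close>)
  have eq: "((\<integral>x. (U n x - Y x)\<^sup>2 \<partial>M) - (\<integral>x. (U' x - Y x)\<^sup>2 \<partial>M)) / e n =
      2 * (\<integral>x. (U' x - Y x) * D n x \<partial>M) + e n * (\<integral>x. (D n x)\<^sup>2 \<partial>M)" for n
  proof -
    have ZD: "integrable M (\<lambda>x. (U' x - Y x) * D n x)"
      by (intro integrable_mult_of_L2 Z2 D2) measurable
    have U: "U n x = U' x + e n * D n x" for x
      using e(2)[of n] by (simp add: D_def)
    have "(\<integral>x. (U n x - Y x)\<^sup>2 \<partial>M) =
        (\<integral>x. (U' x - Y x)\<^sup>2 + ((2 * e n) * ((U' x - Y x) * D n x) + (e n)\<^sup>2 * (D n x)\<^sup>2) \<partial>M)"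
      unfolding U by (intro Bochner_Integration.integral_cong) (auto simp: power2_eq_square algebra_simps)
    also have "\<dots> = (\<integral>x. (U' x - Y x)\<^sup>2 \<partial>M) +
        ((2 * e n) * (\<integral>x. (U' x - Y x) * D n x \<partial>M) + (e n)\<^sup>2 * (\<integral>x. (D n x)\<^sup>2 \<partial>M))"
      using Z2 ZD D2 by simp
    finally show ?thesis
      using e(2)[of n] by (simp add: field_simps power2_eq_square)
  qed
  have "(\<lambda>n. e n * (\<integral>x. (D n x)\<^sup>2 \<partial>M)) \<longlonglongrightarrow> 0"
  proof (rule tendsto_0_le[OF e(1), where K = C])
    show "eventually (\<lambda>n. norm (e n * (\<integral>x. (D n x)\<^sup>2 \<partial>M)) \<le> norm (e n) * C) sequentially"
      using DC by (intro always_eventually allI) (auto simp: abs_mult intro!: mult_left_mono)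
  qed
  from tendsto_add[OF tendsto_mult[OF tendsto_const weak, of 2] this]
  show ?thesis unfolding eq by simp
qed

section \<open>The squared distance from a moving law to a fixed target\<close>

text \<open>Comparison from the right gives \<open>F' \<le> D\<close>; from the left the sign of the
denominator turns it into \<open>D \<le> F'\<close>.\<close>

lemma derivative_of_touching_minorant:
  fixes F g :: "real \<Rightarrow> real"
  assumes F: "(F has_real_derivative F') (at t)"
    and touch: "F t = g t"
    and e: "e \<longlonglongrightarrow> 0" "\<And>n. 0 < e n"
    and minor: "\<And>n. F (t + e n) \<le> g (t + e n)" "\<And>n. F (t - e n) \<le> g (t - e n)"
    and g_right: "(\<lambda>n. (g (t + e n) - g t) / e n) \<longlonglongrightarrow> D"
    and g_left: "(\<lambda>n. (g (t - e n) - g t) / (- e n)) \<longlonglongrightarrow> D"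
  shows "F' = D"
proof (rule antisym)
  have F0: "((\<lambda>h. (F (t + h) - F t) / h) \<longlongrightarrow> F') (at 0)"
    using F by (simp add: DERIV_def)
  have "filterlim e (at 0) sequentially" "filterlim (\<lambda>n. - e n) (at 0) sequentially"
    using e tendsto_minus[OF e(1)] by (auto simp: filterlim_at less_imp_neq[symmetric])
  from this[THEN filterlim_compose[OF F0]]
  have F_right: "(\<lambda>n. (F (t + e n) - F t) / e n) \<longlonglongrightarrow> F'"
    and F_left: "(\<lambda>n. (F (t - e n) - F t) / (- e n)) \<longlonglongrightarrow> F'"
    by simp_all
  show "F' \<le> D"
    by (rule LIMSEQ_le[OF F_right g_right])
      (use minor touch e in \<open>auto intro!: divide_right_mono exI[of _ 0] simp: less_imp_le\<close>)
  show "D \<le> F'"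
    by (rule LIMSEQ_le[OF g_left F_left])
      (use minor touch e in \<open>auto intro!: divide_right_mono exI[of _ 0] simp: less_imp_le\<close>)
qed

lemma W2_square_le_expected_cost:
  fixes U V :: "'w \<Rightarrow> 'a::euclidean_space"
  assumes [measurable]: "U \<in> borel_measurable M" "V \<in> borel_measurable M"
    and int: "integrable M (\<lambda>\<omega>. (norm (U \<omega> - V \<omega>))\<^sup>2)"
  shows "(W2 (distr M borel U) (distr M borel V))\<^sup>2 \<le> (\<integral>\<omega>. (norm (U \<omega> - V \<omega>))\<^sup>2 \<partial>M)"
proof -
  let ?\<gamma> = "distr M borel (\<lambda>\<omega>. (U \<omega>, V \<omega>))"
  let ?cost = "\<lambda>\<gamma>. \<integral>\<^sup>+ z. ennreal ((norm (fst z - snd z :: 'a))\<^sup>2) \<partial>\<gamma>"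
  have pair[measurable]: "(\<lambda>\<omega>. (U \<omega>, V \<omega>)) \<in> measurable M borel"
    by (rule borel_measurable_Pair) measurable
  have [measurable]: "(fst :: 'a \<times> 'a \<Rightarrow> 'a) \<in> borel_measurable borel" "(snd :: 'a \<times> 'a \<Rightarrow> 'a) \<in> borel_measurable borel"
    by (auto intro!: borel_measurable_continuous_onI continuous_intros)
  have "?\<gamma> \<in> couplings (distr M borel U) (distr M borel V)"
    by (simp add: couplings_def distr_distr comp_def)
  then have "(INF \<gamma>\<in>couplings (distr M borel U) (distr M borel V). ?cost \<gamma>) \<le> ?cost ?\<gamma>"
    by (rule INF_lower)
  also have "?cost ?\<gamma> = (\<integral>\<^sup>+ \<omega>. ennreal ((norm (U \<omega> - V \<omega>))\<^sup>2) \<partial>M)"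
    by (subst nn_integral_distr) auto
  also have "\<dots> = ennreal (\<integral>\<omega>. (norm (U \<omega> - V \<omega>))\<^sup>2 \<partial>M)"
    using int by (intro nn_integral_eq_integral) auto
  finally show ?thesis
    by (simp add: W2_def enn2real_leI)
qed

text \<open>The heart of the argument: the optimal partner \<open>S (U t)\<close> is kept frozen while \<open>U s\<close>
moves, which gives an admissible plan for each \<open>s\<close> and the optimal one for \<open>s = t\<close>. The set \<open>I\<close>
collects the times at which \<open>U\<close> must be square integrable.\<close>

lemma derivative_W2_square_to_fixed_target:
  fixes U :: "real \<Rightarrow> 'w \<Rightarrow> real" and V :: "'w \<Rightarrow> real"
  assumes U: "\<And>s. s \<in> I \<Longrightarrow> U s \<in> borel_measurable M"
      "\<And>s. s \<in> I \<Longrightarrow> integrable M (\<lambda>\<omega>. (U s \<omega>)\<^sup>2)"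
    and I: "t \<in> I" "\<And>n. t + e n \<in> I" "\<And>n. t - e n \<in> I"
    and e: "e \<longlonglongrightarrow> 0" "\<And>n. 0 < e n"
    and increment: "\<And>n. (\<integral>\<omega>. (U (t + e n) \<omega> - U t \<omega>)\<^sup>2 \<partial>M) \<le> C * (e n)\<^sup>2"
      "\<And>n. (\<integral>\<omega>. (U (t - e n) \<omega> - U t \<omega>)\<^sup>2 \<partial>M) \<le> C * (e n)\<^sup>2"
    and V[measurable]: "V \<in> borel_measurable M" and V2: "integrable M (\<lambda>\<omega>. (V \<omega>)\<^sup>2)"
    and paths: "AE \<omega> in M. ((\<lambda>s. U s \<omega>) has_real_derivative V \<omega>) (at t)"
    and opt: "optimal_map (distr M borel (U t)) \<nu> S"
    and \<nu>2: "integrable \<nu> (\<lambda>y. y\<^sup>2)"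
    and deriv: "((\<lambda>s. (W2 (distr M borel (U s)) \<nu>)\<^sup>2) has_real_derivative F') (at t)"
  shows "F' = 2 * (\<integral>\<omega>. (U t \<omega> - S (U t \<omega>)) * V \<omega> \<partial>M)"
proof -
  note [measurable] = U(1)[OF I(1)] U(1)[OF I(2)] U(1)[OF I(3)]
  have S[measurable]: "S \<in> borel_measurable borel" and S\<nu>: "distr (distr M borel (U t)) borel S = \<nu>"
    and Sopt: "(W2 (distr M borel (U t)) \<nu>)\<^sup>2 = (\<integral>s. (norm (s - S s))\<^sup>2 \<partial>distr M borel (U t))"
    using opt by (auto simp: optimal_map_def)
  define Y where "Y \<omega> = S (U t \<omega>)" for \<omega>
  have Y[measurable]: "Y \<in> borel_measurable M"
    unfolding Y_def by measurable
  have \<nu>: "distr M borel Y = \<nu>"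
    using S\<nu> by (subst (asm) distr_distr) (auto simp: comp_def Y_def[abs_def])
  have Y2: "integrable M (\<lambda>\<omega>. (Y \<omega>)\<^sup>2)"
    using \<nu>2 unfolding \<nu>[symmetric] by (subst (asm) integrable_distr_eq) auto
  define g where "g s = (\<integral>\<omega>. (U s \<omega> - Y \<omega>)\<^sup>2 \<partial>M)" for s
  have minor: "(W2 (distr M borel (U s)) \<nu>)\<^sup>2 \<le> g s" if "s \<in> I" for s
    using W2_square_le_expected_cost[of "U s" M Y] integrable_square_diff[OF U(1)[OF that] Y U(2)[OF that] Y2]
      U(1)[OF that] Y unfolding \<nu> g_def by simp
  have touch: "(W2 (distr M borel (U t)) \<nu>)\<^sup>2 = g t"
    unfolding Sopt g_def Y_def by (subst integral_distr) auto
  have filt: "filterlim (\<lambda>n. t + e n) (at t) sequentially" "filterlim (\<lambda>n. t + - e n) (at t) sequentially"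
    using tendsto_add[OF tendsto_const e(1), of t] tendsto_diff[OF tendsto_const e(1), of t] e(2)
    by (auto simp: filterlim_at less_imp_neq[symmetric])
  have lim: "AE \<omega> in M. (\<lambda>n. (U (t + d n) \<omega> - U t \<omega>) / d n) \<longlonglongrightarrow> V \<omega>"
    if d: "filterlim (\<lambda>n. t + d n) (at t) sequentially" for d :: "nat \<Rightarrow> real"
    using paths
  proof eventually_elim
    case (elim \<omega>)
    from difference_quotient_LIMSEQ[OF elim[unfolded has_real_derivative_iff_has_vector_derivative] d]
    show ?case by (simp add: divide_inverse mult.commute)
  qed
  have "(\<lambda>n. (g (t + e n) - g t) / e n) \<longlonglongrightarrow> 2 * (\<integral>\<omega>. (U t \<omega> - Y \<omega>) * V \<omega> \<partial>M)"
    unfolding g_def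
    by (rule mean_square_difference_quotient_LIMSEQ[where C = C])
      (use U(2) I Y2 V2 e less_imp_neq[OF e(2)] increment lim[OF filt(1)] in auto)
  moreover have "(\<lambda>n. (g (t - e n) - g t) / (- e n)) \<longlonglongrightarrow> 2 * (\<integral>\<omega>. (U t \<omega> - Y \<omega>) * V \<omega> \<partial>M)"
    unfolding g_def
    by (rule mean_square_difference_quotient_LIMSEQ[where C = C])
      (use U(2) I Y2 V2 tendsto_minus[OF e(1)] less_imp_neq[OF e(2)] increment lim[OF filt(2)] in auto)
  ultimately show ?thesis
    using derivative_of_touching_minorant[of "\<lambda>s. (W2 (distr M borel (U s)) \<nu>)\<^sup>2" F' t g e, OF deriv touch e] minor I
    unfolding Y_def by blast
qed

section \<open>Integration over the sphere\<close>

lemma sphere_unif_measurable_ident: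
  "(\<lambda>\<theta>. \<theta>) \<in> borel_measurable (sphere_unif :: 'a::euclidean_space measure)"
  unfolding sphere_unif_def by (rule measurable_restrict_space1) simp

lemma sphere_moment_measurable:
  fixes f :: "'a::euclidean_space \<Rightarrow> 'a \<Rightarrow> real"
  assumes "case_prod f \<in> borel_measurable (sphere_unif \<Otimes>\<^sub>M borel)"
  shows "(\<lambda>x. \<integral>\<theta>. f \<theta> x *\<^sub>R \<theta> \<partial>sphere_unif) \<in> borel_measurable borel"
proof -
  interpret S: prob_space "sphere_unif :: 'a measure" by (rule prob_space_sphere_unif)
  note [measurable] = sphere_unif_measurable_ident
  have [measurable]: "(\<lambda>p. f (snd p) (fst p)) \<in> borel_measurable (borel \<Otimes>\<^sub>M sphere_unif)"
    using measurable_compose[OF measurable_pair_swap' assms] by (simp add: case_prod_beta)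
  have "(\<lambda>x. \<integral>\<theta>. f (snd (x, \<theta>)) (fst (x, \<theta>)) *\<^sub>R \<theta> \<partial>sphere_unif) \<in> borel_measurable borel"
    by measurable
  then show ?thesis by simp
qed

text \<open>Square integrability of \<open>f\<close> on the product and of \<open>w\<close> makes the double integral absolutely
convergent. It also makes \<open>f \<theta> x\<close> integrable in \<open>\<theta>\<close> for almost every \<open>x\<close>; without this the
vector-valued integral on the right would have the default value 0 and the inner product could not
be taken out.\<close>

lemma
  fixes f :: "'a::euclidean_space \<Rightarrow> 'a \<Rightarrow> real" and w :: "'a \<Rightarrow> 'a"
  assumes "prob_space \<mu>" and sets\<mu>: "sets \<mu> = sets borel"
    and f: "case_prod f \<in> borel_measurable (sphere_unif \<Otimes>\<^sub>M borel)"
    and w: "w \<in> borel_measurable borel" and w2: "integrable \<mu> (\<lambda>x. (norm (w x))\<^sup>2)"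
    and f2: "(\<integral>\<^sup>+ \<theta>. (\<integral>\<^sup>+ x. ennreal ((f \<theta> x)\<^sup>2) \<partial>\<mu>) \<partial>sphere_unif) < \<infinity>"
  shows integrable_sphere_integral:
      "integrable sphere_unif (\<lambda>\<theta>. \<integral>x. f \<theta> x * (\<theta> \<bullet> w x) \<partial>\<mu>)" (is ?int)
    and sphere_integral_swap: "(\<integral>\<theta>. (\<integral>x. f \<theta> x * (\<theta> \<bullet> w x) \<partial>\<mu>) \<partial>sphere_unif) =
      (\<integral>x. (\<integral>\<theta>. f \<theta> x *\<^sub>R \<theta> \<partial>sphere_unif) \<bullet> w x \<partial>\<mu>)" (is ?swap)
proof -
  let ?S = "sphere_unif :: 'a measure"
  interpret S: prob_space ?S by (rule prob_space_sphere_unif)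
  interpret \<mu>: prob_space \<mu> by fact
  interpret P: pair_prob_space ?S \<mu> ..
  have [measurable]: "(\<lambda>p. f (fst p) (snd p)) \<in> borel_measurable (?S \<Otimes>\<^sub>M \<mu>)"
    using f unfolding case_prod_beta
    by (simp add: measurable_cong_sets[OF sets_pair_measure_cong[OF refl sets\<mu>] refl])
  note [measurable] = sphere_unif_measurable_ident
  have [measurable]: "w \<in> borel_measurable \<mu>"
    using w by (simp add: measurable_cong_sets[OF sets\<mu> refl])
  have norm1: "norm (fst p) = 1" if "p \<in> space (?S \<Otimes>\<^sub>M \<mu>)" for p
    using that by (auto simp: space_pair_measure space_sphere_unif)
  have F2: "integrable (?S \<Otimes>\<^sub>M \<mu>) (\<lambda>p. (f (fst p) (snd p))\<^sup>2)"
  proof (rule integrableI_bounded)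
    show "(\<integral>\<^sup>+ p. ennreal (norm ((f (fst p) (snd p))\<^sup>2)) \<partial>(?S \<Otimes>\<^sub>M \<mu>)) < \<infinity>"
      using f2 by (subst \<mu>.nn_integral_fst[symmetric]) auto
  qed measurable
  have W2: "integrable (?S \<Otimes>\<^sub>M \<mu>) (\<lambda>p. (norm (w (snd p)))\<^sup>2)"
  proof (rule integrableI_bounded)
    have "(\<integral>\<^sup>+ x. ennreal ((norm (w x))\<^sup>2) \<partial>\<mu>) < \<infinity>"
      using w2 by (simp add: integrable_iff_bounded)
    then show "(\<integral>\<^sup>+ p. ennreal (norm ((norm (w (snd p)))\<^sup>2)) \<partial>(?S \<Otimes>\<^sub>M \<mu>)) < \<infinity>"
      by (subst \<mu>.nn_integral_fst[symmetric]) (auto simp: S.emeasure_space_1)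
  qed measurable
  have in2: "integrable (?S \<Otimes>\<^sub>M \<mu>) (\<lambda>p. (fst p \<bullet> w (snd p))\<^sup>2)"
  proof (rule Bochner_Integration.integrable_bound[OF W2])
    show "AE p in ?S \<Otimes>\<^sub>M \<mu>. norm ((fst p \<bullet> w (snd p))\<^sup>2) \<le> norm ((norm (w (snd p)))\<^sup>2)"
    proof (rule AE_I2)
      fix p assume "p \<in> space (?S \<Otimes>\<^sub>M \<mu>)"
      then have "\<bar>fst p \<bullet> w (snd p)\<bar> \<le> norm (w (snd p))"
        using Cauchy_Schwarz_ineq2[of "fst p" "w (snd p)"] norm1 by simp
      then show "norm ((fst p \<bullet> w (snd p))\<^sup>2) \<le> norm ((norm (w (snd p)))\<^sup>2)"
        by (simp add: abs_le_square_iff[symmetric])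
    qed
  qed measurable
  have prod: "integrable (?S \<Otimes>\<^sub>M \<mu>) (\<lambda>(\<theta>, x). f \<theta> x * (\<theta> \<bullet> w x))"
    unfolding case_prod_beta by (intro integrable_mult_of_L2 F2 in2) measurable
  have F1: "integrable (?S \<Otimes>\<^sub>M \<mu>) (case_prod f)"
    unfolding case_prod_beta
    using integrable_mult_of_L2[of "\<lambda>p. f (fst p) (snd p)" "?S \<Otimes>\<^sub>M \<mu>" "\<lambda>_. 1"] F2 by simp
  have [measurable]: "(\<lambda>p. f (snd p) (fst p)) \<in> borel_measurable (\<mu> \<Otimes>\<^sub>M ?S)"
    using measurable_compose[OF measurable_pair_swap', of "\<lambda>p. f (fst p) (snd p)"]
    by (simp add: case_prod_beta)
  have inner: "(\<integral>\<theta>. f \<theta> x * (\<theta> \<bullet> w x) \<partial>?S) = (\<integral>\<theta>. f \<theta> x *\<^sub>R \<theta> \<partial>?S) \<bullet> w x"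
    if int: "integrable ?S (\<lambda>\<theta>. f \<theta> x)" for x
  proof -
    have "integrable ?S (\<lambda>\<theta>. f \<theta> x *\<^sub>R \<theta>)"
    proof (rule Bochner_Integration.integrable_bound[OF int])
      show "(\<lambda>\<theta>. f \<theta> x *\<^sub>R \<theta>) \<in> borel_measurable ?S"
        using borel_measurable_integrable[OF int] by measurable
    qed (auto simp: space_sphere_unif)
    then show ?thesis by (simp add: integral_inner_left[symmetric])
  qed
  have "(\<integral>\<theta>. (\<integral>x. f \<theta> x * (\<theta> \<bullet> w x) \<partial>\<mu>) \<partial>?S) = (\<integral>x. (\<integral>\<theta>. f \<theta> x * (\<theta> \<bullet> w x) \<partial>?S) \<partial>\<mu>)"
    using P.Fubini_integral[OF prod] by simp
  also have "\<dots> = (\<integral>x. (\<integral>\<theta>. f \<theta> x *\<^sub>R \<theta> \<partial>?S) \<bullet> w x \<partial>\<mu>)"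
  proof (rule integral_cong_AE)
    show "AE x in \<mu>. (\<integral>\<theta>. f \<theta> x * (\<theta> \<bullet> w x) \<partial>?S) = (\<integral>\<theta>. f \<theta> x *\<^sub>R \<theta> \<partial>?S) \<bullet> w x"
      using P.AE_integrable_snd[OF F1] by eventually_elim (rule inner)
    have "(\<lambda>x. \<integral>\<theta>. f (snd (x, \<theta>)) (fst (x, \<theta>)) * (\<theta> \<bullet> w x) \<partial>?S) \<in> borel_measurable \<mu>"
      by measurable
    then show "(\<lambda>x. \<integral>\<theta>. f \<theta> x * (\<theta> \<bullet> w x) \<partial>?S) \<in> borel_measurable \<mu>" by simp
    show "(\<lambda>x. (\<integral>\<theta>. f \<theta> x *\<^sub>R \<theta> \<partial>?S) \<bullet> w x) \<in> borel_measurable \<mu>"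
      using sphere_moment_measurable[OF f] w by (simp add: measurable_cong_sets[OF sets\<mu> refl])
  qed
  finally show ?swap .
  show ?int using P.integrable_fst[OF prod] .
qed

section \<open>Mean square regularity of the state\<close>

lemma distr_borel_eq_dens:
  assumes "distributed M lborel Z (\<lambda>x. ennreal (p x))"
  shows "distr M borel Z = dens p"
  using distributed_distr_eq_density[OF assms] unfolding dens_def
  by (metis distr_cong sets_lborel)

text \<open>The norm of \<open>v r\<close> in \<open>L\<^sup>2(\<rho> r)\<close>, extended by zero outside the open time interval so
that its integrals can be taken over the whole line.\<close>

definition speed :: "real \<Rightarrow> (real \<Rightarrow> 'a::euclidean_space \<Rightarrow> real) \<Rightarrow> (real \<Rightarrow> 'a \<Rightarrow> 'a) \<Rightarrow> real \<Rightarrow> real"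
  where "speed T \<rho> v r = indicator {0<..<T} r * sqrt (\<integral>x. (norm (v r x))\<^sup>2 * \<rho> r x \<partial>lborel)"

lemma speed_measurable_and_finite:
  assumes "L2_velocity T \<rho> v"
  shows "speed T \<rho> v \<in> borel_measurable borel" "(\<integral>\<^sup>+ r. ennreal (speed T \<rho> v r) \<partial>lborel) < \<infinity>"
proof -
  have int: "integrable lborel (speed T \<rho> v)"
    using assms by (simp add: L2_velocity_def set_integrable_def speed_def[abs_def])
  then show "speed T \<rho> v \<in> borel_measurable borel"
    by (simp add: integrable_iff_bounded)
  have "(\<integral>\<^sup>+ r. ennreal (speed T \<rho> v r) \<partial>lborel) \<le> (\<integral>\<^sup>+ r. ennreal (norm (speed T \<rho> v r)) \<partial>lborel)"
    by (intro nn_integral_mono ennreal_leI) simp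
  also have "\<dots> < \<infinity>" using int by (simp add: integrable_iff_bounded)
  finally show "(\<integral>\<^sup>+ r. ennreal (speed T \<rho> v r) \<partial>lborel) < \<infinity>" .
qed

text \<open>Where the density vanishes, \<open>u\<close> is arbitrary and perhaps not measurable, whereas the flux
\<open>p u\<close> is measurable. Dividing the flux by the density gives a Borel function that the state cannot
distinguish from \<open>u\<close>.\<close>

lemma velocity_representative:
  fixes u :: "'a::euclidean_space \<Rightarrow> 'a"
  assumes Z: "distributed M lborel Z (\<lambda>x. ennreal (p x))"
    and nonneg: "\<And>x. 0 \<le> p x"
    and flux[measurable]: "(\<lambda>x. p x *\<^sub>R u x) \<in> borel_measurable borel"
    and int: "integrable lborel (\<lambda>x. (norm (u x))\<^sup>2 * p x)"
  obtains w where "w \<in> borel_measurable borel" "\<And>x. p x *\<^sub>R w x = p x *\<^sub>R u x"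
    "AE \<omega> in M. w (Z \<omega>) = u (Z \<omega>)" "integrable M (\<lambda>\<omega>. (norm (w (Z \<omega>)))\<^sup>2)"
    "(\<integral>\<omega>. (norm (w (Z \<omega>)))\<^sup>2 \<partial>M) = (\<integral>x. (norm (u x))\<^sup>2 * p x \<partial>lborel)"
proof
  have p[measurable]: "p \<in> borel_measurable borel"
    using distributed_real_measurable[OF _ Z] nonneg by simp
  have Zm[measurable]: "Z \<in> borel_measurable M"
    using distributed_measurable[OF Z] by simp
  define w where "w x = p x *\<^sub>R u x /\<^sub>R p x" for x
  show [measurable]: "w \<in> borel_measurable borel"
    unfolding w_def by measurable
  show "p x *\<^sub>R w x = p x *\<^sub>R u x" for x
    by (cases "p x = 0") (simp_all add: w_def)
  have "AE x in distr M lborel Z. w x = u x"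
    unfolding distributed_distr_eq_density[OF Z]
    by (subst AE_density) (auto simp: w_def less_imp_neq[symmetric])
  then show "AE \<omega> in M. w (Z \<omega>) = u (Z \<omega>)"
    by (rule AE_distrD[rotated]) simp
  have eq: "p x * (norm (w x))\<^sup>2 = (norm (u x))\<^sup>2 * p x" for x
    by (cases "p x = 0") (simp_all add: w_def)
  show "integrable M (\<lambda>\<omega>. (norm (w (Z \<omega>)))\<^sup>2)"
    using int distributed_integrable[OF Z, of "\<lambda>x. (norm (w x))\<^sup>2"] nonneg unfolding eq by simp
  show "(\<integral>\<omega>. (norm (w (Z \<omega>)))\<^sup>2 \<partial>M) = (\<integral>x. (norm (u x))\<^sup>2 * p x \<partial>lborel)"
    using distributed_integral[OF Z, of "\<lambda>x. (norm (w x))\<^sup>2"] nonneg unfolding eq by simp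
qed

text \<open>Along a good path the increment is bounded by the time integral of the speed of that path.
The Minkowski inequality turns this into a bound for the \<open>L\<^sup>2\<close> norms, as \<open>v r (X r)\<close> has the same
\<open>L\<^sup>2\<close> norm as \<open>v r\<close> under the law of the state.\<close>

lemma flow_increment_L2_bound:
  fixes v :: "real \<Rightarrow> 'a::euclidean_space \<Rightarrow> 'a"
  assumes state: "state_process M X v \<rho>"
    and velocity: "L2_velocity T \<rho> v"
    and nonneg: "\<And>t x. t \<ge> 0 \<Longrightarrow> \<rho> t x \<ge> 0"
    and flux: "\<And>t. t > 0 \<Longrightarrow> (\<lambda>x. \<rho> t x *\<^sub>R v t x) \<in> borel_measurable borel"
    and ab: "0 \<le> a" "a \<le> b" "b \<le> T"
  shows "(\<integral>\<^sup>+ \<omega>. ennreal ((norm (X b \<omega> - X a \<omega>))\<^sup>2) \<partial>M)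
    \<le> (\<integral>\<^sup>+ r. ennreal (speed T \<rho> v r) * indicator {a..b} r \<partial>lborel)\<^sup>2"
proof -
  interpret M: prob_space M using state by (simp add: state_process_def)
  have X: "distributed M lborel (X r) (\<lambda>x. ennreal (\<rho> r x))" if "0 \<le> r" for r
    using state that by (simp add: state_process_def)
  have Xm[measurable]: "X r \<in> borel_measurable M" if "0 \<le> r" for r
    using distributed_measurable[OF X[OF that]] by simp
  have "AE \<omega> in M. \<forall>t\<ge>0. ((\<lambda>s. X s \<omega>) has_vector_derivative v t (X t \<omega>)) (at t within {0..})"
    using state by (simp add: state_process_def)
  then obtain N where N: "{\<omega> \<in> space M. \<not> (\<forall>t\<ge>0. ((\<lambda>s. X s \<omega>) has_vector_derivative v t (X t \<omega>)) (at t within {0..}))} \<subseteq> N"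
      "N \<in> null_sets M"
    by (auto elim!: AE_E)
  \<comment> \<open>Outside \<open>G\<close> the paths may be irregular, so they are replaced by zero there.\<close>
  define G where "G = space M - N"
  have [measurable]: "G \<in> sets M" using N(2) by (auto simp: G_def)
  have AEG: "AE \<omega> in M. \<omega> \<in> G"
    using AE_not_in[OF N(2)] AE_space by eventually_elim (simp add: G_def)
  define X' where "X' r \<omega> = indicat_real G \<omega> *\<^sub>R X r \<omega>" for r \<omega>
  define V' where "V' r \<omega> = indicat_real G \<omega> *\<^sub>R v r (X r \<omega>)" for r \<omega>
  have [measurable]: "X' r \<in> borel_measurable M" if "0 \<le> r" for r
    unfolding X'_def using Xm[OF that] by measurable
  have deriv: "((\<lambda>s. X' s \<omega>) has_vector_derivative V' r \<omega>) (at r within {0..})"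
    if "0 \<le> r" "\<omega> \<in> space M" for r \<omega>
    using that N(1) by (cases "\<omega> \<in> G") (auto simp: X'_def V'_def G_def)
  define K where "K r \<omega> = indicat_real {0..} r *\<^sub>R V' r \<omega>" for r \<omega>
  have "case_prod K \<in> borel_measurable (borel \<Otimes>\<^sub>M M)"
    using measurable_path_derivative[where X = X' and V = V', OF _ deriv] unfolding K_def by simp
  then have K[measurable]: "case_prod K \<in> borel_measurable (lborel \<Otimes>\<^sub>M M)"
    by (simp add: measurable_cong_sets[OF sets_pair_measure_cong[OF sets_lborel refl] refl])
  define L where "L r \<omega> = ennreal (norm (K r \<omega>)) * indicator {a..b} r" for r \<omega>
  have L: "case_prod L \<in> borel_measurable (lborel \<Otimes>\<^sub>M M)"
    unfolding L_def case_prod_beta using K unfolding case_prod_beta by measurable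
  have path: "ennreal (norm (X' b \<omega> - X' a \<omega>)) \<le> (\<integral>\<^sup>+ r. L r \<omega> \<partial>lborel)" if \<omega>: "\<omega> \<in> space M" for \<omega>
    unfolding L_def
  proof (rule norm_increment_le_nn_integral_derivative[OF ab(2)])
    show "((\<lambda>s. X' s \<omega>) has_vector_derivative K r \<omega>) (at r within {a..b})" if "r \<in> {a..b}" for r
      using has_vector_derivative_within_subset[OF deriv[OF _ \<omega>], of r "{a..b}"] that ab by (auto simp: K_def)
    have [measurable]: "(\<lambda>r. K r \<omega>) \<in> borel_measurable lborel"
      using measurable_compose[OF measurable_Pair2'[OF \<omega>] K] by simp
    show "(\<lambda>r. indicat_real {a..b} r *\<^sub>R K r \<omega>) \<in> borel_measurable lborel"
      by measurable
  qed
  note [measurable] = speed_measurable_and_finite(1)[OF velocity]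
  have bound: "AE r in lborel. (\<integral>\<^sup>+ \<omega>. (L r \<omega>)\<^sup>2 \<partial>M) \<le> (ennreal (speed T \<rho> v r) * indicator {a..b} r)\<^sup>2"
  proof -
    have "AE r in lborel. r \<noteq> 0 \<and> r \<noteq> T"
      using AE_lborel_singleton[of 0] AE_lborel_singleton[of T] by eventually_elim simp
    moreover have "AE r in lborel. r \<in> {0<..<T} \<longrightarrow> integrable lborel (\<lambda>x. (norm (v r x))\<^sup>2 * \<rho> r x)"
      using velocity by (simp add: L2_velocity_def)
    ultimately show ?thesis
    proof eventually_elim
      case (elim r)
      show ?case
      proof (cases "r \<in> {a..b}")
        case True
        then have r: "r \<in> {0<..<T}" using elim ab by auto
        then have "0 \<le> r" "0 < r" by auto
        have int: "integrable lborel (\<lambda>x. (norm (v r x))\<^sup>2 * \<rho> r x)" using elim r by simp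
        obtain w where w[measurable]: "w \<in> borel_measurable borel"
          and wv: "AE \<omega> in M. w (X r \<omega>) = v r (X r \<omega>)"
          and w2: "integrable M (\<lambda>\<omega>. (norm (w (X r \<omega>)))\<^sup>2)"
          and wint: "(\<integral>\<omega>. (norm (w (X r \<omega>)))\<^sup>2 \<partial>M) = (\<integral>x. (norm (v r x))\<^sup>2 * \<rho> r x \<partial>lborel)"
          by (rule velocity_representative[OF X[OF \<open>0 \<le> r\<close>] nonneg[OF \<open>0 \<le> r\<close>] flux[OF \<open>0 < r\<close>] int]) (rule that)
        have "(\<integral>\<^sup>+ \<omega>. (L r \<omega>)\<^sup>2 \<partial>M) = (\<integral>\<^sup>+ \<omega>. ennreal ((norm (w (X r \<omega>)))\<^sup>2) \<partial>M)"
        proof (rule nn_integral_cong_AE)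
          show "AE \<omega> in M. (L r \<omega>)\<^sup>2 = ennreal ((norm (w (X r \<omega>)))\<^sup>2)"
            using wv AEG by eventually_elim (use True \<open>0 \<le> r\<close> in \<open>simp add: L_def K_def V'_def ennreal_power\<close>)
        qed
        also have "\<dots> = ennreal (\<integral>x. (norm (v r x))\<^sup>2 * \<rho> r x \<partial>lborel)"
          using w2 by (subst nn_integral_eq_integral) (auto simp: wint)
        also have "\<dots> = (ennreal (speed T \<rho> v r))\<^sup>2"
          using r nonneg[OF \<open>0 \<le> r\<close>] by (simp add: speed_def ennreal_power)
        finally show ?thesis using True by simp
      qed (simp add: L_def)
    qed
  qed
  have "(\<integral>\<^sup>+ \<omega>. ennreal ((norm (X b \<omega> - X a \<omega>))\<^sup>2) \<partial>M) = (\<integral>\<^sup>+ \<omega>. ennreal ((norm (X' b \<omega> - X' a \<omega>))\<^sup>2) \<partial>M)"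
    by (rule nn_integral_cong_AE) (use AEG in eventually_elim, simp add: X'_def)
  also have "\<dots> \<le> (\<integral>\<^sup>+ \<omega>. (\<integral>\<^sup>+ r. L r \<omega> \<partial>lborel)\<^sup>2 \<partial>M)"
    using path by (intro nn_integral_mono) (simp add: ennreal_power[symmetric] power_mono_ennreal)
  also have "\<dots> \<le> (\<integral>\<^sup>+ r. ennreal (speed T \<rho> v r) * indicator {a..b} r \<partial>lborel)\<^sup>2"
    by (rule nn_integral_Minkowski_L2[OF _ _ L _ bound]) (auto intro: M.sigma_finite_measure_axioms sigma_finite_lborel)
  finally show ?thesis .
qed

text \<open>At almost every time there is a sequence of step sizes along which the difference quotients
of the state, forward and backward, stay bounded in \<open>L\<^sup>2\<close>. The same steps serve both sides of \<open>t\<close>, because the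
averages of the speed are taken over intervals centred at \<open>t\<close>.\<close>

lemma AE_difference_quotients_L2_bounded:
  fixes v :: "real \<Rightarrow> 'a::euclidean_space \<Rightarrow> 'a"
  assumes state: "state_process M X v \<rho>"
    and velocity: "L2_velocity T \<rho> v"
    and nonneg: "\<And>t x. t \<ge> 0 \<Longrightarrow> \<rho> t x \<ge> 0"
    and flux: "\<And>t. t > 0 \<Longrightarrow> (\<lambda>x. \<rho> t x *\<^sub>R v t x) \<in> borel_measurable borel"
  shows "AE t in lborel. t \<in> {0<..<T} \<longrightarrow> (\<exists>e C. e \<longlonglongrightarrow> 0 \<and>
    (\<forall>n. 0 < e n \<and> 0 < t - e n \<and> t + e n < T \<and>
      (\<forall>s\<in>{t + e n, t - e n}. (\<integral>\<omega>. (norm (X s \<omega> - X t \<omega>))\<^sup>2 \<partial>M) \<le> C * (e n)\<^sup>2)))"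
proof -
  let ?h = "\<lambda>r. ennreal (speed T \<rho> v r)"
  note [measurable] = speed_measurable_and_finite(1)[OF velocity]
  have "AE t in lborel. liminf (\<lambda>n. ennreal (real (Suc n)) *
    (\<integral>\<^sup>+ r. ?h r * indicator {t - 1 / real (Suc n)..t + 1 / real (Suc n)} r \<partial>lborel)) < \<infinity>"
    by (rule AE_liminf_averages_finite[OF _ speed_measurable_and_finite(2)[OF velocity]]) measurable
  then show ?thesis
  proof eventually_elim
    case (elim t)
    define J where "J e = (\<integral>\<^sup>+ r. ?h r * indicator {t - e..t + e} r \<partial>lborel)" for e
    show ?case
    proof
      assume t: "t \<in> {0<..<T}"
      let ?lim = "liminf (\<lambda>n. ennreal (real (Suc n)) * J (1 / real (Suc n)))"
      have "?lim < \<infinity>" using elim unfolding J_def .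
      then obtain m :: nat where m: "?lim < of_nat m"
        using ennreal_Ex_less_of_nat[of ?lim] by (auto simp: infinity_ennreal_def)
      define C where "C = real m"
      have C: "?lim < ennreal C" "0 \<le> C"
        using m by (simp_all add: C_def ennreal_of_nat_eq_real_of_nat)
      have "\<not> eventually (\<lambda>n. ennreal C \<le> ennreal (real (Suc n)) * J (1 / real (Suc n))) sequentially"
        using C(1) Liminf_bounded[of "ennreal C" _ sequentially] by (meson not_le)
      then have "frequently (\<lambda>n. ennreal (real (Suc n)) * J (1 / real (Suc n)) < ennreal C) sequentially"
        unfolding frequently_def not_less .
      moreover have "eventually (\<lambda>n. 1 / real (Suc n) < min t (T - t)) sequentially"
        using order_tendstoD(2)[OF LIMSEQ_Suc[OF lim_1_over_n], of "min t (T - t)"] t by auto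
      ultimately have "frequently (\<lambda>n. ennreal (real (Suc n)) * J (1 / real (Suc n)) < ennreal C
          \<and> 1 / real (Suc n) < min t (T - t)) sequentially"
        by (rule frequently_eventually_frequently)
      then have "infinite {n. ennreal (real (Suc n)) * J (1 / real (Suc n)) < ennreal C
          \<and> 1 / real (Suc n) < min t (T - t)}"
        by (simp add: frequently_cofinite flip: cofinite_eq_sequentially)
      from infinite_enumerate[OF this] obtain k :: "nat \<Rightarrow> nat" where k: "strict_mono k"
        "\<And>n. ennreal (real (Suc (k n))) * J (1 / real (Suc (k n))) < ennreal C"
        "\<And>n. 1 / real (Suc (k n)) < min t (T - t)"
        by auto
      define e where "e n = 1 / real (Suc (k n))" for n
      have e0: "0 < e n" for n by (simp add: e_def)
      have elim0: "e \<longlonglongrightarrow> 0"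
        using LIMSEQ_subseq_LIMSEQ[OF LIMSEQ_Suc[OF lim_1_over_n] k(1)] by (simp add: e_def[abs_def] comp_def)
      have JC: "J (e n) \<le> ennreal (C * e n)" for n
      proof -
        have "J (e n) = ennreal (e n) * (ennreal (real (Suc (k n))) * J (e n))"
          by (simp add: mult.assoc[symmetric] ennreal_mult[symmetric] e_def del: of_nat_Suc)
        also have "\<dots> \<le> ennreal (e n) * ennreal C"
          using less_imp_le[OF k(2)[of n]] by (intro mult_left_mono) (auto simp: e_def)
        also have "\<dots> = ennreal (C * e n)"
          using C(2) e0[of n] by (simp add: ennreal_mult mult.commute)
        finally show ?thesis .
      qed
      have bound: "(\<integral>\<omega>. (norm (X b \<omega> - X a \<omega>))\<^sup>2 \<partial>M) \<le> C\<^sup>2 * (e n)\<^sup>2"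
        if ab: "a \<in> {t - e n..t + e n}" "b \<in> {t - e n..t + e n}" "a \<le> b" for a b n
      proof -
        have "(\<integral>\<^sup>+ \<omega>. ennreal ((norm (X b \<omega> - X a \<omega>))\<^sup>2) \<partial>M) \<le> (\<integral>\<^sup>+ r. ?h r * indicator {a..b} r \<partial>lborel)\<^sup>2"
          by (rule flow_increment_L2_bound[OF state velocity nonneg flux])
            (use ab k(3)[of n] in \<open>auto simp: e_def\<close>)
        also have "\<dots> \<le> (J (e n))\<^sup>2"
          unfolding J_def using ab by (intro power_mono_ennreal nn_integral_mono mult_left_mono) (auto simp: indicator_def)
        also have "\<dots> \<le> (ennreal (C * e n))\<^sup>2"
          by (rule power_mono_ennreal[OF JC])
        also have "\<dots> = ennreal (C\<^sup>2 * (e n)\<^sup>2)"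
          using C(2) e0[of n] by (simp add: ennreal_power power_mult_distrib)
        finally have "enn2real (\<integral>\<^sup>+ \<omega>. ennreal ((norm (X b \<omega> - X a \<omega>))\<^sup>2) \<partial>M) \<le> C\<^sup>2 * (e n)\<^sup>2"
          by (rule enn2real_leI[rotated]) simp
        moreover have "(\<integral>\<omega>. (norm (X b \<omega> - X a \<omega>))\<^sup>2 \<partial>M) \<le> enn2real (\<integral>\<^sup>+ \<omega>. ennreal ((norm (X b \<omega> - X a \<omega>))\<^sup>2) \<partial>M)"
        \<comment> \<open>A function that is not measurable has Bochner integral 0 by convention, which is below the bound.\<close>
        proof (cases "(\<lambda>\<omega>. (norm (X b \<omega> - X a \<omega>))\<^sup>2) \<in> borel_measurable M")
          case True
          then show ?thesis by (simp add: integral_eq_nn_integral)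
        next
          case False
          then have "\<not> integrable M (\<lambda>\<omega>. (norm (X b \<omega> - X a \<omega>))\<^sup>2)" by auto
          then show ?thesis by (simp add: not_integrable_integral_eq)
        qed
        ultimately show ?thesis by linarith
      qed
      show "\<exists>e C. e \<longlonglongrightarrow> 0 \<and> (\<forall>n. 0 < e n \<and> 0 < t - e n \<and> t + e n < T \<and>
        (\<forall>s\<in>{t + e n, t - e n}. (\<integral>\<omega>. (norm (X s \<omega> - X t \<omega>))\<^sup>2 \<partial>M) \<le> C * (e n)\<^sup>2))"
      proof (intro exI[of _ e] exI[of _ "C\<^sup>2"] conjI allI ballI)
        fix n s assume "s \<in> {t + e n, t - e n}"
        then show "(\<integral>\<omega>. (norm (X s \<omega> - X t \<omega>))\<^sup>2 \<partial>M) \<le> C\<^sup>2 * (e n)\<^sup>2"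
          using bound[of t n "t + e n"] bound[of "t - e n" n t] e0[of n] by (auto simp: norm_minus_commute)
      qed (use elim0 e0 k(3) in \<open>auto simp: e_def min_less_iff_conj less_diff_eq add.commute\<close>)
    qed
  qed
qed

text \<open>The initial state has a finite second moment, and the increment from time 0 is square
integrable.\<close>

lemma state_square_integrable:
  fixes v :: "real \<Rightarrow> 'a::euclidean_space \<Rightarrow> 'a"
  assumes state: "state_process M X v \<rho>"
    and velocity: "L2_velocity T \<rho> v"
    and nonneg: "\<And>t x. t \<ge> 0 \<Longrightarrow> \<rho> t x \<ge> 0"
    and flux: "\<And>t. t > 0 \<Longrightarrow> (\<lambda>x. \<rho> t x *\<^sub>R v t x) \<in> borel_measurable borel"
    and initial: "dens (\<rho> 0) \<in> P2"
    and s: "0 \<le> s" "s \<le> T"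
  shows "integrable M (\<lambda>\<omega>. (norm (X s \<omega>))\<^sup>2)"
proof -
  have X: "distributed M lborel (X r) (\<lambda>x. ennreal (\<rho> r x))" if "0 \<le> r" for r
    using state that by (simp add: state_process_def)
  have Xm[measurable]: "X r \<in> borel_measurable M" if "0 \<le> r" for r
    using distributed_measurable[OF X[OF that]] by simp
  note [measurable] = Xm[OF s(1)] Xm[OF order_refl]
  have X0: "integrable M (\<lambda>\<omega>. (norm (X 0 \<omega>))\<^sup>2)"
    using initial unfolding P2_def distr_borel_eq_dens[OF X[OF order_refl], symmetric]
    by (auto simp: integrable_distr_eq)
  let ?h = "\<lambda>r. ennreal (speed T \<rho> v r)"
  have "(\<integral>\<^sup>+ r. ?h r * indicator {0..s} r \<partial>lborel) \<le> (\<integral>\<^sup>+ r. ?h r \<partial>lborel)"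
    by (intro nn_integral_mono) (auto simp: indicator_def)
  also have "\<dots> < \<infinity>" by (rule speed_measurable_and_finite(2)[OF velocity])
  finally have fin: "(\<integral>\<^sup>+ r. ?h r * indicator {0..s} r \<partial>lborel)\<^sup>2 < \<infinity>"
    by (simp add: power_less_top_ennreal)
  have inc: "integrable M (\<lambda>\<omega>. (norm (X s \<omega> - X 0 \<omega>))\<^sup>2)"
  proof (rule integrableI_bounded)
    show "(\<integral>\<^sup>+ \<omega>. ennreal (norm ((norm (X s \<omega> - X 0 \<omega>))\<^sup>2)) \<partial>M) < \<infinity>"
      using le_less_trans[OF flow_increment_L2_bound[OF state velocity nonneg flux order_refl s] fin] by simp
  qed measurable
  show ?thesis
    using integrable_norm_square_diff[of "\<lambda>\<omega>. X s \<omega> - X 0 \<omega>" M "\<lambda>\<omega>. - X 0 \<omega>"] inc X0 by simp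
qed

section \<open>The derivative of the sliced distance\<close>

lemma proj_dens_eq_distr:
  assumes "distributed M lborel Z (\<lambda>x. ennreal (p x))"
  shows "proj \<theta> (dens p) = distr M borel (\<lambda>\<omega>. \<theta> \<bullet> Z \<omega>)"
proof -
  have [measurable]: "Z \<in> borel_measurable M"
    using distributed_measurable[OF assms] by simp
  show ?thesis
    unfolding proj_def distr_borel_eq_dens[OF assms, symmetric] by (subst distr_distr) (auto simp: comp_def)
qed

lemma deriv_projected_W2_square:
  fixes X :: "real \<Rightarrow> 'w \<Rightarrow> 'a::euclidean_space"
  assumes X: "\<And>s. s \<in> {0<..<T} \<Longrightarrow> distributed M lborel (X s) (\<lambda>x. ennreal (\<rho> s x))"
    and X2: "\<And>s. s \<in> {0<..<T} \<Longrightarrow> integrable M (\<lambda>\<omega>. (norm (X s \<omega>))\<^sup>2)"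
    and t: "t \<in> {0<..<T}"
    and e: "e \<longlonglongrightarrow> 0" "\<And>n. 0 < e n" "\<And>n. 0 < t - e n" "\<And>n. t + e n < T"
    and increment: "\<And>n s. s \<in> {t + e n, t - e n} \<Longrightarrow>
      (\<integral>\<omega>. (norm (X s \<omega> - X t \<omega>))\<^sup>2 \<partial>M) \<le> C * (e n)\<^sup>2"
    and V[measurable]: "V \<in> borel_measurable M" and V2: "integrable M (\<lambda>\<omega>. (norm (V \<omega>))\<^sup>2)"
    and paths: "AE \<omega> in M. ((\<lambda>s. X s \<omega>) has_vector_derivative V \<omega>) (at t)"
    and \<theta>: "norm \<theta> = 1"
    and opt: "optimal_map (proj \<theta> (dens (\<rho> t))) (proj \<theta> \<nu>) S"
    and \<nu>: "\<nu> \<in> P2"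
    and diff: "(\<lambda>s. (W2 (proj \<theta> (dens (\<rho> s))) (proj \<theta> \<nu>))\<^sup>2) differentiable (at t)"
  shows "deriv (\<lambda>s. (W2 (proj \<theta> (dens (\<rho> s))) (proj \<theta> \<nu>))\<^sup>2) t =
    2 * (\<integral>\<omega>. (\<theta> \<bullet> X t \<omega> - S (\<theta> \<bullet> X t \<omega>)) * (\<theta> \<bullet> V \<omega>) \<partial>M)"
proof -
  have Xm: "X s \<in> borel_measurable M" if "s \<in> {0<..<T}" for s
    using distributed_measurable[OF X[OF that]] by simp
  note \<theta>le = inner_unit_square_le[OF \<theta>]
  have proj2: "integrable N (\<lambda>\<omega>. (\<theta> \<bullet> Z \<omega>)\<^sup>2)"
    if "integrable N (\<lambda>\<omega>. (norm (Z \<omega>))\<^sup>2)" "Z \<in> borel_measurable N" for Z :: "'b \<Rightarrow> 'a" and N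
  proof (rule Bochner_Integration.integrable_bound[OF that(1)])
    show "(\<lambda>\<omega>. (\<theta> \<bullet> Z \<omega>)\<^sup>2) \<in> borel_measurable N" using that(2) by measurable
  qed (use \<theta>le in simp)
  have inI: "t + e n \<in> {0<..<T}" "t - e n \<in> {0<..<T}" for n
    using e(2-4)[of n] t by auto
  have inc: "(\<integral>\<omega>. (\<theta> \<bullet> X s \<omega> - \<theta> \<bullet> X t \<omega>)\<^sup>2 \<partial>M) \<le> C * (e n)\<^sup>2" if s: "s \<in> {t + e n, t - e n}" for s n
  proof -
    have sI: "s \<in> {0<..<T}" using s inI by auto
    note [measurable] = Xm[OF sI] Xm[OF t]
    have d2: "integrable M (\<lambda>\<omega>. (norm (X s \<omega> - X t \<omega>))\<^sup>2)"
      using X2[OF sI] X2[OF t] by (intro integrable_norm_square_diff) measurable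
    have "(\<integral>\<omega>. (\<theta> \<bullet> X s \<omega> - \<theta> \<bullet> X t \<omega>)\<^sup>2 \<partial>M) \<le> (\<integral>\<omega>. (norm (X s \<omega> - X t \<omega>))\<^sup>2 \<partial>M)"
      unfolding inner_diff_right[symmetric]
      by (intro integral_mono proj2[OF d2] d2 \<theta>le) measurable
    then show ?thesis using increment[OF s] by linarith
  qed
  let ?F = "\<lambda>s. (W2 (proj \<theta> (dens (\<rho> s))) (proj \<theta> \<nu>))\<^sup>2"
  have "(?F has_real_derivative deriv ?F t) (at t)"
    using diff by (simp add: DERIV_deriv_iff_real_differentiable)
  then have F: "((\<lambda>s. (W2 (distr M borel (\<lambda>\<omega>. \<theta> \<bullet> X s \<omega>)) (proj \<theta> \<nu>))\<^sup>2) has_real_derivative deriv ?F t) (at t)"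
    by (rule has_field_derivative_transform_within_open[where S = "{0<..<T}"])
      (use t in \<open>auto simp: proj_dens_eq_distr[OF X]\<close>)
  have \<nu>2: "integrable (proj \<theta> \<nu>) (\<lambda>y. y\<^sup>2)"
  proof -
    have sets\<nu>: "sets \<nu> = sets borel" using \<nu> by (simp add: P2_def)
    have [measurable]: "(\<lambda>x. x) \<in> borel_measurable \<nu>"
      by (simp add: measurable_cong_sets[OF sets\<nu> refl])
    show ?thesis unfolding proj_def
      using proj2[of \<nu> "\<lambda>x. x"] \<nu> by (subst integrable_distr_eq) (auto simp: P2_def)
  qed
  show ?thesis
  proof (rule derivative_W2_square_to_fixed_target[OF _ _ t inI e(1,2) inc inc _ _ _ _ \<nu>2 F])
    show "AE \<omega> in M. ((\<lambda>s. \<theta> \<bullet> X s \<omega>) has_real_derivative \<theta> \<bullet> V \<omega>) (at t)"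
      using paths by eventually_elim
        (auto simp: has_real_derivative_iff_has_vector_derivative intro: bounded_linear.has_vector_derivative[OF bounded_linear_inner_right])
    show "optimal_map (distr M borel (\<lambda>\<omega>. \<theta> \<bullet> X t \<omega>)) (proj \<theta> \<nu>) S"
      using opt by (simp add: proj_dens_eq_distr[OF X[OF t]])
  qed (use Xm X2 V2 in \<open>auto intro!: proj2\<close>)
qed

text \<open>The optimal map pushes the projection of \<open>\<mu>\<close> to that of \<open>\<nu>\<close>, so its second moment is
one of \<open>\<nu>\<close>. The bound is uniform in \<open>\<theta>\<close>, which makes the displacement square integrable over the
sphere as well.\<close>

lemma nn_integral_projected_displacement_le:
  assumes opt: "optimal_map (proj \<theta> \<mu>) (proj \<theta> \<nu>) S" and \<theta>: "norm \<theta> = 1"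
    and sets: "sets \<mu> = sets borel" "sets \<nu> = sets borel"
  shows "(\<integral>\<^sup>+ x. ennreal ((\<theta> \<bullet> x - S (\<theta> \<bullet> x))\<^sup>2) \<partial>\<mu>) \<le>
    2 * (\<integral>\<^sup>+ x. ennreal ((norm x)\<^sup>2) \<partial>\<mu>) + 2 * (\<integral>\<^sup>+ x. ennreal ((norm x)\<^sup>2) \<partial>\<nu>)"
proof -
  have S[measurable]: "S \<in> borel_measurable borel" and S\<nu>: "distr (proj \<theta> \<mu>) borel S = proj \<theta> \<nu>"
    using opt by (auto simp: optimal_map_def)
  have id: "(\<lambda>x. x) \<in> borel_measurable \<mu>" "(\<lambda>x. x) \<in> borel_measurable \<nu>"
    by (simp_all add: measurable_cong_sets[OF sets(1) refl] measurable_cong_sets[OF sets(2) refl])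
  note [measurable] = id
  note \<theta>le = inner_unit_square_le[OF \<theta>]
  have "(a - b)\<^sup>2 \<le> 2 * a\<^sup>2 + 2 * b\<^sup>2" for a b :: real
    using norm_diff_square_le[of a b] by simp
  then have "(\<integral>\<^sup>+ x. ennreal ((\<theta> \<bullet> x - S (\<theta> \<bullet> x))\<^sup>2) \<partial>\<mu>) \<le>
      (\<integral>\<^sup>+ x. 2 * ennreal ((\<theta> \<bullet> x)\<^sup>2) + 2 * ennreal ((S (\<theta> \<bullet> x))\<^sup>2) \<partial>\<mu>)"
    by (intro nn_integral_mono) (simp add: ennreal_plus[symmetric] ennreal_mult''[symmetric] ennreal_leI
        del: ennreal_plus flip: ennreal_numeral)
  also have "\<dots> = 2 * (\<integral>\<^sup>+ x. ennreal ((\<theta> \<bullet> x)\<^sup>2) \<partial>\<mu>) + 2 * (\<integral>\<^sup>+ x. ennreal ((S (\<theta> \<bullet> x))\<^sup>2) \<partial>\<mu>)"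
    by (simp add: nn_integral_add nn_integral_cmult)
  also have "(\<integral>\<^sup>+ x. ennreal ((S (\<theta> \<bullet> x))\<^sup>2) \<partial>\<mu>) = (\<integral>\<^sup>+ y. ennreal (y\<^sup>2) \<partial>distr (proj \<theta> \<mu>) borel S)"
    unfolding proj_def by (simp add: nn_integral_distr)
  also have "\<dots> = (\<integral>\<^sup>+ x. ennreal ((\<theta> \<bullet> x)\<^sup>2) \<partial>\<nu>)"
    unfolding S\<nu> unfolding proj_def by (simp add: nn_integral_distr)
  also have "2 * (\<integral>\<^sup>+ x. ennreal ((\<theta> \<bullet> x)\<^sup>2) \<partial>\<mu>) + 2 * \<dots> \<le>
      2 * (\<integral>\<^sup>+ x. ennreal ((norm x)\<^sup>2) \<partial>\<mu>) + 2 * (\<integral>\<^sup>+ x. ennreal ((norm x)\<^sup>2) \<partial>\<nu>)"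
    by (intro add_mono mult_left_mono nn_integral_mono ennreal_leI \<theta>le) auto
  finally show ?thesis .
qed

theorem proposition1:
  fixes T :: real
    and \<rho>\<^sub>0 \<rho>\<^sub>f :: "real ^ 'n \<Rightarrow> real"
    and v :: "real \<Rightarrow> real ^ 'n \<Rightarrow> real ^ 'n"
    and \<rho> :: "real \<Rightarrow> real ^ 'n \<Rightarrow> real"
    and M :: "'w measure"
    and X :: "real \<Rightarrow> 'w \<Rightarrow> real ^ 'n"
    and \<T> :: "real \<Rightarrow> real ^ 'n \<Rightarrow> real \<Rightarrow> real"
  assumes "T > 0"
    and "prob_density_P2 \<rho>\<^sub>0"
    and "prob_density_P2 \<rho>\<^sub>f"
    and nonneg: "\<And>t x. t \<ge> 0 \<Longrightarrow> \<rho> t x \<ge> 0"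
    and initial: "\<And>x. \<rho> 0 x = \<rho>\<^sub>0 x"
    and state: "state_process M X v \<rho>"
    and continuity: "classical_continuity_eq \<rho> v"
    and velocity: "L2_velocity T \<rho> v"
    and interchange: "AE t in lborel. t \<in> {0<..<T} \<longrightarrow> interchange_at (\<lambda>s. dens (\<rho> s)) (dens \<rho>\<^sub>f) t"
    and decay: "\<And>i t x. t \<ge> 0 \<Longrightarrow>
      ((\<lambda>s. let y = (\<chi> j. if j = i then s else x $ j) in \<rho> t y * v t y $ i) \<longlongrightarrow> 0) at_infinity"
    and optimal: "\<And>t \<theta>. t \<in> {0<..<T} \<Longrightarrow> \<theta> \<in> sphere 0 1 \<Longrightarrow>
      optimal_map (proj \<theta> (dens (\<rho> t))) (proj \<theta> (dens \<rho>\<^sub>f)) (\<T> t \<theta>)"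
    and measurable_maps: "\<And>t. t \<in> {0<..<T} \<Longrightarrow>
      (\<lambda>(\<theta>, s). \<T> t \<theta> s) \<in> borel_measurable (sphere_unif \<Otimes>\<^sub>M borel)"
  shows "AE t in lborel. t \<in> {0<..<T} \<longrightarrow>
    ((\<lambda>s. (SW2 (dens (\<rho> s)) (dens \<rho>\<^sub>f))\<^sup>2) has_real_derivative
      2 * (\<integral>x. (\<integral>\<theta>. (\<theta> \<bullet> x - \<T> t \<theta> (\<theta> \<bullet> x)) *\<^sub>R \<theta> \<partial>sphere_unif) \<bullet> v t x * \<rho> t x \<partial>lborel)) (at t)"
proof -
  let ?S = "sphere_unif :: (real ^ 'n) measure"
  interpret M: prob_space M using state by (simp add: state_process_def)
  have X: "distributed M lborel (X r) (\<lambda>x. ennreal (\<rho> r x))" if "0 \<le> r" for r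
    using state that by (simp add: state_process_def)
  have \<rho>f: "dens \<rho>\<^sub>f \<in> P2"
    using assms(3) by (simp add: prob_density_P2_def)
  have \<rho>0: "dens (\<rho> 0) \<in> P2"
    using assms(2) initial by (simp add: prob_density_P2_def dens_def)
  \<comment> \<open>The flux of a classical solution is differentiable in space, hence continuous.\<close>
  have flux: "(\<lambda>x. \<rho> t x *\<^sub>R v t x) \<in> borel_measurable borel" if "t > 0" for t
    using continuity that
    by (auto simp: classical_continuity_eq_def intro!: borel_measurable_continuous_onI
        differentiable_imp_continuous_on differentiable_at_imp_differentiable_on)
  have X2: "integrable M (\<lambda>\<omega>. (norm (X s \<omega>))\<^sup>2)" if "s \<in> {0<..<T}" for s
    using state_square_integrable[OF state velocity nonneg flux \<rho>0, of s] that by auto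
  have velocity_int: "AE t in lborel. t \<in> {0<..<T} \<longrightarrow> integrable lborel (\<lambda>x. (norm (v t x))\<^sup>2 * \<rho> t x)"
    using velocity by (simp add: L2_velocity_def)
  have increments: "AE t in lborel. t \<in> {0<..<T} \<longrightarrow> (\<exists>e C. e \<longlonglongrightarrow> 0 \<and>
    (\<forall>n. 0 < e n \<and> 0 < t - e n \<and> t + e n < T \<and>
      (\<forall>s\<in>{t + e n, t - e n}. (\<integral>\<omega>. (norm (X s \<omega> - X t \<omega>))\<^sup>2 \<partial>M) \<le> C * (e n)\<^sup>2)))"
    by (rule AE_difference_quotients_L2_bounded[OF state velocity nonneg flux])
  from increments interchange velocity_int show ?thesis
  proof eventually_elim
    case (elim t)
    show ?case
    proof
      assume t: "t \<in> {0<..<T}"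
      then have t0: "0 \<le> t" "0 < t" by auto
      obtain e C where e: "e \<longlonglongrightarrow> 0" "\<And>n. 0 < e n" "\<And>n. 0 < t - e n" "\<And>n. t + e n < T"
        and inc: "\<And>n s. s \<in> {t + e n, t - e n} \<Longrightarrow> (\<integral>\<omega>. (norm (X s \<omega> - X t \<omega>))\<^sup>2 \<partial>M) \<le> C * (e n)\<^sup>2"
        using elim(1) t by blast
      have swap: "interchange_at (\<lambda>s. dens (\<rho> s)) (dens \<rho>\<^sub>f) t" using elim(2) t by simp
      have int: "integrable lborel (\<lambda>x. (norm (v t x))\<^sup>2 * \<rho> t x)" using elim(3) t by simp
      obtain w where w[measurable]: "w \<in> borel_measurable borel"
        and \<rho>w: "\<And>x. \<rho> t x *\<^sub>R w x = \<rho> t x *\<^sub>R v t x"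
        and wv: "AE \<omega> in M. w (X t \<omega>) = v t (X t \<omega>)"
        and w2: "integrable M (\<lambda>\<omega>. (norm (w (X t \<omega>)))\<^sup>2)"
        by (rule velocity_representative[OF X[OF t0(1)] nonneg[OF t0(1)] flux[OF t0(2)] int]) (rule that)
      have Xt[measurable]: "X t \<in> borel_measurable M"
        using distributed_measurable[OF X[OF t0(1)]] by simp
      define \<mu> where "\<mu> = dens (\<rho> t)"
      have \<mu>: "distr M borel (X t) = \<mu>"
        unfolding \<mu>_def by (rule distr_borel_eq_dens[OF X[OF t0(1)]])
      have prob\<mu>: "prob_space \<mu>" and sets\<mu>: "sets \<mu> = sets borel"
        unfolding \<mu>[symmetric] by (auto intro: M.prob_space_distr)
      have \<mu>w2: "integrable \<mu> (\<lambda>x. (norm (w x))\<^sup>2)"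
        unfolding \<mu>[symmetric] using w2 by (subst integrable_distr_eq) auto
      have \<mu>2: "integrable \<mu> (\<lambda>x. (norm x)\<^sup>2)"
        unfolding \<mu>[symmetric] using X2[OF t] by (subst integrable_distr_eq) auto
      define f where "f \<theta> x = \<theta> \<bullet> x - \<T> t \<theta> (\<theta> \<bullet> x)" for \<theta> x
      have f: "case_prod f \<in> borel_measurable (?S \<Otimes>\<^sub>M borel)"
      proof -
        note [measurable] = sphere_unif_measurable_ident
        have "(\<lambda>p. (fst p, fst p \<bullet> snd p)) \<in> measurable (?S \<Otimes>\<^sub>M borel) (?S \<Otimes>\<^sub>M borel)"
          by measurable
        from measurable_compose[OF this measurable_maps[OF t]]
        have [measurable]: "(\<lambda>p. \<T> t (fst p) (fst p \<bullet> snd p)) \<in> borel_measurable (?S \<Otimes>\<^sub>M borel)"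
          by simp
        show ?thesis
          unfolding f_def case_prod_beta by measurable
      qed
      have f_borel: "f \<theta> \<in> borel_measurable borel" if "norm \<theta> = 1" for \<theta>
        using measurable_compose[OF measurable_Pair1' f, of \<theta>] that by (simp add: space_sphere_unif)
      have f2: "(\<integral>\<^sup>+ \<theta>. (\<integral>\<^sup>+ x. ennreal ((f \<theta> x)\<^sup>2) \<partial>\<mu>) \<partial>?S) < \<infinity>"
      proof -
        interpret S: prob_space ?S by (rule prob_space_sphere_unif)
        let ?K = "2 * (\<integral>\<^sup>+ x. ennreal ((norm x)\<^sup>2) \<partial>\<mu>) + 2 * (\<integral>\<^sup>+ x. ennreal ((norm x)\<^sup>2) \<partial>dens \<rho>\<^sub>f)"
        have "(\<integral>\<^sup>+ \<theta>. (\<integral>\<^sup>+ x. ennreal ((f \<theta> x)\<^sup>2) \<partial>\<mu>) \<partial>?S) \<le> (\<integral>\<^sup>+ \<theta>. ?K \<partial>?S)"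
          unfolding f_def using optimal[OF t] sets\<mu> \<rho>f
          by (intro nn_integral_mono nn_integral_projected_displacement_le)
            (auto simp: space_sphere_unif \<mu>_def P2_def)
        also have "\<dots> = ?K" by (simp add: S.emeasure_space_1)
        also have "\<dots> < \<infinity>"
          using \<mu>2 \<rho>f by (simp add: P2_def integrable_iff_bounded ennreal_mult_less_top)
        finally show ?thesis .
      qed
      let ?F = "\<lambda>\<theta> s. (W2 (proj \<theta> (dens (\<rho> s))) (proj \<theta> (dens \<rho>\<^sub>f)))\<^sup>2"
      have paths: "AE \<omega> in M. ((\<lambda>s. X s \<omega>) has_vector_derivative w (X t \<omega>)) (at t)"
      proof -
        have "AE \<omega> in M. \<forall>t\<ge>0. ((\<lambda>s. X s \<omega>) has_vector_derivative v t (X t \<omega>)) (at t within {0..})"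
          using state by (simp add: state_process_def)
        with wv show ?thesis
        proof eventually_elim
          case (elim \<omega>)
          have "at t within {0..} = at t"
            using t0 by (intro at_within_interior) simp
          with elim t0 show ?case by metis
        qed
      qed
      have F': "deriv (?F \<theta>) t = 2 * (\<integral>x. f \<theta> x * (\<theta> \<bullet> w x) \<partial>\<mu>)"
        if \<theta>: "\<theta> \<in> space ?S" and diff: "?F \<theta> differentiable (at t)" for \<theta>
      proof -
        have n\<theta>: "norm \<theta> = 1" using \<theta> by (simp add: space_sphere_unif)
        have "deriv (?F \<theta>) t = 2 * (\<integral>\<omega>. f \<theta> (X t \<omega>) * (\<theta> \<bullet> w (X t \<omega>)) \<partial>M)"
          unfolding f_def
          by (rule deriv_projected_W2_square[OF _ X2 t e inc _ w2 paths n\<theta> _ \<rho>f diff])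
            (use X optimal[OF t] n\<theta> in auto)
        also have "(\<integral>\<omega>. f \<theta> (X t \<omega>) * (\<theta> \<bullet> w (X t \<omega>)) \<partial>M) = (\<integral>x. f \<theta> x * (\<theta> \<bullet> w x) \<partial>\<mu>)"
          unfolding \<mu>[symmetric] using f_borel[OF n\<theta>] by (subst integral_distr) auto
        finally show ?thesis .
      qed
      have "(\<integral>\<theta>. deriv (?F \<theta>) t \<partial>?S) = (\<integral>\<theta>. 2 * (\<integral>x. f \<theta> x * (\<theta> \<bullet> w x) \<partial>\<mu>) \<partial>?S)"
      proof (rule integral_cong_AE)
        show "(\<lambda>\<theta>. deriv (?F \<theta>) t) \<in> borel_measurable ?S"
          using swap by (intro borel_measurable_integrable) (simp add: interchange_at_def)
        show "(\<lambda>\<theta>. 2 * (\<integral>x. f \<theta> x * (\<theta> \<bullet> w x) \<partial>\<mu>)) \<in> borel_measurable ?S"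
          using integrable_sphere_integral[OF prob\<mu> sets\<mu> f w \<mu>w2 f2] by simp
        have "AE \<theta> in ?S. ?F \<theta> differentiable (at t)"
          using swap by (simp add: interchange_at_def)
        then show "AE \<theta> in ?S. deriv (?F \<theta>) t = 2 * (\<integral>x. f \<theta> x * (\<theta> \<bullet> w x) \<partial>\<mu>)"
          using AE_space by eventually_elim (rule F')
      qed
      also have "\<dots> = 2 * (\<integral>x. (\<integral>\<theta>. f \<theta> x *\<^sub>R \<theta> \<partial>?S) \<bullet> w x \<partial>\<mu>)"
        using sphere_integral_swap[OF prob\<mu> sets\<mu> f w \<mu>w2 f2] by simp
      also have "(\<integral>x. (\<integral>\<theta>. f \<theta> x *\<^sub>R \<theta> \<partial>?S) \<bullet> w x \<partial>\<mu>) =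
          (\<integral>x. \<rho> t x * ((\<integral>\<theta>. f \<theta> x *\<^sub>R \<theta> \<partial>?S) \<bullet> w x) \<partial>lborel)"
        unfolding \<mu>_def dens_def
        using sphere_moment_measurable[OF f] distributed_real_measurable[OF _ X[OF t0(1)]] nonneg[OF t0(1)]
        by (intro integral_real_density) auto
      also have "\<dots> = (\<integral>x. (\<integral>\<theta>. f \<theta> x *\<^sub>R \<theta> \<partial>?S) \<bullet> v t x * \<rho> t x \<partial>lborel)"
      proof (intro Bochner_Integration.integral_cong refl)
        fix x
        \<comment> \<open>Here \<open>w\<close> gives way to \<open>v t\<close>: they differ only where the density vanishes.\<close>
        have "\<rho> t x * (A \<bullet> w x) = A \<bullet> v t x * \<rho> t x" for A
          using arg_cong[OF \<rho>w[of x], of "\<lambda>y. A \<bullet> y"] by (simp add: mult.commute)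
        then show "\<rho> t x * ((\<integral>\<theta>. f \<theta> x *\<^sub>R \<theta> \<partial>?S) \<bullet> w x) = (\<integral>\<theta>. f \<theta> x *\<^sub>R \<theta> \<partial>?S) \<bullet> v t x * \<rho> t x" .
      qed
      finally show "((\<lambda>s. (SW2 (dens (\<rho> s)) (dens \<rho>\<^sub>f))\<^sup>2) has_real_derivative
        2 * (\<integral>x. (\<integral>\<theta>. (\<theta> \<bullet> x - \<T> t \<theta> (\<theta> \<bullet> x)) *\<^sub>R \<theta> \<partial>?S) \<bullet> v t x * \<rho> t x \<partial>lborel)) (at t)"
        using swap unfolding f_def by (simp add: interchange_at_def)
    qed
  qed
qed

end
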